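(* There exist absolute constants such that the following holds. Let $G=(V,E,c)$ be any (not necessarily complete) capacitated graph on $n$ vertices whose capacities are polynomially bounded, and let $h\ge 1$. Then there exists an $h$-hop oblivious routing for $G$ with hop stretch $O(\log^7 n)$ and congestion approximation $O(\log^2 n\cdot \log^2(h\log n))$.
   Context: A capacitated graph $G=(V,E,c)$ is an undirected graph with capacities $c:E\to[1/L,L]$; "polynomially bounded" means $L=\mathrm{poly}(n)$, $n=|V|$. Paths may be non-simple; $\mathrm{hop}(p)$ is the number of edges of a path $p$. A flow is a vector in $\mathbb{R}_{\ge0}^{E}$; the flow $\mathrm{flow}(p)$ of a path $p$ has $e$-coordinate equal to the number of times $p$ traverses $e$. The congestion of a flow $f$ is $\mathrm{cong}(f)=\max_{e\in E} f_e/c_e$. A routing scheme $R=\{R_{u,v}\}_{u,v\in V}$ consists, for each pair $u,v$, of a probability distribution $R_{u,v}$ over paths in $G$ between $u$ and $v$. A demand is a matrix $\mathcal{D}:V\times V\to\mathbb{R}_{\ge0}$. The flow routing $\mathcal{D}$ via $R$ is $\mathrm{flow}(\mathcal{D},R)=\sum_{s,t}\mathcal{D}_{s,t}\,\mathbb{E}_{p\sim R_{s,t}}[\mathrm{flow}(p)]$, and $\mathrm{cong}(\mathcal{D},R)=\mathrm{cong}(\mathrm{flow}(\mathcal{D},R))$. For $h\ge1$, $\mathrm{opt}^{(h)}(\mathcal{D})$ is the minimum of $\mathrm{cong}(\mathcal{D},R)$ over all routing schemes $R$ whose distributions are supported on paths with at most $h$ hops (it is $+\infty$ if no such scheme exists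 for the pairs in the support of $\mathcal{D}$). An $h$-hop oblivious routing is a routing scheme $R$; it has hop stretch $\beta\ge1$ if every path in the support of every $R_{s,t}$ has at most $\beta h$ hops, and congestion approximation $\alpha\ge1$ if $\mathrm{cong}(\mathcal{D},R)\le\alpha\cdot\mathrm{opt}^{(h)}(\mathcal{D})$ for every demand $\mathcal{D}$.
   Formalization: The routing need only serve pairs joined by a path of at most βh hops (other pairs admit no distribution of hop stretch β, e.g. the ends of a long path graph with h = 1), and n ≥ 2 is assumed since log 1 = 0 contradicts β ≥ 1. *)

theory Defs
  imports "HOL-Probability.Probability" "HOL-Library.Landau_Symbols"
begin

text \<open>Finite simple undirected graphs with positive edge capacities; an edge is a two-element set
  of vertices.\<close>

locale capacitated_graph =
  fixes V :: "'v set" and E :: "'v set set" and c :: "'v set \<Rightarrow> real"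
  assumes finite_vertices: "finite V"
    and edge_ends: "e \<in> E \<Longrightarrow> \<exists>u\<in>V. \<exists>v\<in>V. u \<noteq> v \<and> e = {u, v}"
    and capacity_pos: "e \<in> E \<Longrightarrow> c e > 0"

definition polynomially_bounded :: "(nat \<Rightarrow> real) \<Rightarrow> bool" where
  "polynomially_bounded L \<longleftrightarrow> (\<exists>k. L \<in> O(\<lambda>n. real n ^ k))"


text \<open>A path is the list of its vertices, repetitions allowed.  The singleton list is the path with
  no hops from a vertex to itself.\<close>

definition path_between :: "'v set \<Rightarrow> 'v set set \<Rightarrow> 'v \<Rightarrow> 'v \<Rightarrow> 'v list \<Rightarrow> bool" where
  "path_between V E u v p \<longleftrightarrow>
     p \<noteq> [] \<and> set p \<subseteq> V \<and> hd p = u \<and> last p = v \<and> successively (\<lambda>x y. {x, y} \<in> E) p"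

definition path_edges :: "'v list \<Rightarrow> 'v set list" where
  "path_edges p = map (\<lambda>(x, y). {x, y}) (zip p (tl p))"

definition hop :: "'v list \<Rightarrow> nat" where
  "hop p = length (path_edges p)"

definition path_flow :: "'v list \<Rightarrow> 'v set \<Rightarrow> ennreal" where
  "path_flow p e = of_nat (count_list (path_edges p) e)"

text \<open>The supremum over a finite edge set is the maximum; it is \<open>0\<close> if there are no edges.\<close>

definition flow_congestion :: "'v set set \<Rightarrow> ('v set \<Rightarrow> real) \<Rightarrow> ('v set \<Rightarrow> ennreal) \<Rightarrow> ennreal" where
  "flow_congestion E c f = (SUP e\<in>E. f e / ennreal (c e))"


type_synonym 'v routing = "'v \<Rightarrow> 'v \<Rightarrow> 'v list pmf"

text \<open>In a graph that is not complete, some pairs of vertices may be joined by no path at all, or by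
  no path with few enough hops.  Routing schemes are therefore taken relative to the set \<open>P\<close> of pairs
  that they have to serve; values of \<open>R\<close> outside \<open>P\<close> are irrelevant.\<close>

definition routing_scheme ::
    "'v set \<Rightarrow> 'v set set \<Rightarrow> ('v \<times> 'v) set \<Rightarrow> 'v routing \<Rightarrow> bool" where
  "routing_scheme V E P R \<longleftrightarrow>
     (\<forall>(u, v)\<in>P. \<forall>p\<in>set_pmf (R u v). path_between V E u v p)"

definition hop_bounded :: "('v \<times> 'v) set \<Rightarrow> real \<Rightarrow> 'v routing \<Rightarrow> bool" where
  "hop_bounded P k R \<longleftrightarrow> (\<forall>(u, v)\<in>P. \<forall>p\<in>set_pmf (R u v). real (hop p) \<le> k)"

definition is_demand :: "'v set \<Rightarrow> ('v \<Rightarrow> 'v \<Rightarrow> real) \<Rightarrow> bool" where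
  "is_demand V D \<longleftrightarrow> (\<forall>s\<in>V. \<forall>t\<in>V. 0 \<le> D s t)"

definition demand_support :: "'v set \<Rightarrow> ('v \<Rightarrow> 'v \<Rightarrow> real) \<Rightarrow> ('v \<times> 'v) set" where
  "demand_support V D = {(s, t). s \<in> V \<and> t \<in> V \<and> D s t > 0}"

text \<open>Flow values are in \<^typ>\<open>ennreal\<close> because the expected number of traversals is infinite for
  some distributions over paths of unbounded length.\<close>

definition demand_flow :: "'v set \<Rightarrow> ('v \<Rightarrow> 'v \<Rightarrow> real) \<Rightarrow> 'v routing \<Rightarrow> 'v set \<Rightarrow> ennreal" where
  "demand_flow V D R e =
     (\<Sum>s\<in>V. \<Sum>t\<in>V. ennreal (D s t) * (\<integral>\<^sup>+p. path_flow p e \<partial>measure_pmf (R s t)))"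

definition demand_congestion ::
    "'v set \<Rightarrow> 'v set set \<Rightarrow> ('v set \<Rightarrow> real) \<Rightarrow> ('v \<Rightarrow> 'v \<Rightarrow> real) \<Rightarrow> 'v routing \<Rightarrow> ennreal" where
  "demand_congestion V E c D R = flow_congestion E c (demand_flow V D R)"

text \<open>The infimum of the empty set is \<open>\<infinity>\<close>: this is the case where some pair in the support of \<open>D\<close> is
  joined by no path with at most \<open>h\<close> hops.\<close>

definition hop_opt ::
    "'v set \<Rightarrow> 'v set set \<Rightarrow> ('v set \<Rightarrow> real) \<Rightarrow> nat \<Rightarrow> ('v \<Rightarrow> 'v \<Rightarrow> real) \<Rightarrow> ennreal" where
  "hop_opt V E c h D =
     (INF R\<in>{R. routing_scheme V E (demand_support V D) R \<and>
                hop_bounded (demand_support V D) (real h) R}. demand_congestion V E c D R)"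


definition pairs_within :: "'v set \<Rightarrow> 'v set set \<Rightarrow> real \<Rightarrow> ('v \<times> 'v) set" where
  "pairs_within V E k =
     {(s, t). s \<in> V \<and> t \<in> V \<and> (\<exists>p. path_between V E s t p \<and> real (hop p) \<le> k)}"

text \<open>A scheme of hop stretch \<open>\<beta>\<close> must serve every pair that can be served with \<open>\<beta> * h\<close> hops.  As
  \<open>\<beta> \<ge> 1\<close>, every demand with a nonzero entry at another pair has infinite \<^const>\<open>hop_opt\<close>.\<close>

definition hop_oblivious_routing ::
    "'v set \<Rightarrow> 'v set set \<Rightarrow> nat \<Rightarrow> real \<Rightarrow> 'v routing \<Rightarrow> bool" where
  "hop_oblivious_routing V E h \<beta> R \<longleftrightarrow>
     \<beta> \<ge> 1 \<and>
     routing_scheme V E (pairs_within V E (\<beta> * real h)) R \<and>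
     hop_bounded (pairs_within V E (\<beta> * real h)) (\<beta> * real h) R"

definition congestion_approximation ::
    "'v set \<Rightarrow> 'v set set \<Rightarrow> ('v set \<Rightarrow> real) \<Rightarrow> nat \<Rightarrow> real \<Rightarrow> 'v routing \<Rightarrow> bool" where
  "congestion_approximation V E c h \<alpha> R \<longleftrightarrow>
     \<alpha> \<ge> 1 \<and>
     (\<forall>D. is_demand V D \<longrightarrow> demand_congestion V E c D R \<le> ennreal \<alpha> * hop_opt V E c h D)"

end

theory Submission
  imports Defs
begin

text \<open>Fix edge weights \<open>w e = \<lambda> e / c e\<close>, where \<open>\<lambda>\<close> is a distribution on the edges, and write
  \<open>r\<^sub>k = 2 ^ k * \<rho>\<close>.  At every level \<open>k\<close>, region growing partitions the vertices into clusters whose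
  points are \<open>O(log n)\<close> steps from a centre, one step being a walk with at most \<open>h\<close> hops and weight at
  most \<open>r\<^sub>k\<close>; on average, only \<open>O(1)\<close> clusters come within one step of a vertex.  A pair \<open>(s, t)\<close> whose
  lightest \<open>h\<close>-hop walk has weight about \<open>r\<^sub>j\<close> is routed from \<open>s\<close> through the centres of the clusters
  of levels \<open>1, \<dots>, j\<close> that contain \<open>s\<close>, and back down to \<open>t\<close>.  All vertices with the same cluster at
  level \<open>k\<close> and at level \<open>k + 1\<close> share one path, of weight \<open>O(log n) * r\<^sub>k\<close>.  For every demand that is
  routable over \<open>h\<close> hops with congestion \<open>1\<close>, the load on this path is at most the volume
  (\<open>w e * c e\<close> summed over the edges) near the class, divided by \<open>r\<^sub>k\<close>: an \<open>h\<close>-hop walk that starts in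
  the class spends weight \<open>r\<^sub>k\<close> before it leaves the neighbourhood.  Summing over the \<open>O(log n)\<close> levels,
  the \<open>\<lambda>\<close>-average of the congestion is \<open>O(log\<^sup>2 n)\<close>, simultaneously for all demands.  A minimax argument
  over the edges, and over the pairs that some partition separates, turns this into one distribution
  over such routings.  Both the hop stretch and the congestion approximation are \<open>O(log\<^sup>2 n)\<close>; this
  suffices because the remaining logarithmic factors are bounded away from \<open>0\<close>.\<close>

section \<open>Paths\<close>

lemma path_edges_simps [simp]:
  "path_edges [] = []" "path_edges [x] = []"
  "path_edges (x # y # p) = {x, y} # path_edges (y # p)"
  by (simp_all add: path_edges_def)

lemma path_edges_join:
  assumes "p \<noteq> []" "q \<noteq> []" "last p = hd q"
  shows "path_edges (p @ tl q) = path_edges p @ path_edges q"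
  using assms
proof (induction p rule: induct_list012)
  case (2 x)
  then show ?case by (cases q) auto
qed auto

lemma path_edges_rev: "path_edges (rev p) = rev (path_edges p)"
proof (induction p rule: induct_list012)
  case (3 x y zs)
  have "path_edges (rev (x # y # zs)) = path_edges (rev (y # zs) @ tl [y, x])"
    by simp
  also have "\<dots> = path_edges (rev (y # zs)) @ path_edges [y, x]"
    by (rule path_edges_join) auto
  finally show ?case
    using 3 by (simp add: insert_commute)
qed auto

lemma path_between_join:
  assumes "path_between V E u v p" "path_between V E v x q"
  shows "path_between V E u x (p @ tl q)"
proof (cases q)
  case Nil
  with assms show ?thesis by (simp add: path_between_def)
next
  case (Cons y q')
  have "last (p @ q') = x"
    using assms Cons by (cases q') (auto simp: path_between_def)
  moreover have "successively (\<lambda>x y. {x, y} \<in> E) (p @ q')"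
    using assms Cons by (cases q') (auto simp: path_between_def successively_append_iff)
  ultimately show ?thesis
    using assms Cons by (auto simp: path_between_def)
qed

lemma path_between_rev:
  assumes "path_between V E u v p"
  shows "path_between V E v u (rev p)"
  using assms by (auto simp: path_between_def hd_rev last_rev insert_commute)

lemma path_between_edges: "path_between V E u v p \<Longrightarrow> set (path_edges p) \<subseteq> E"
proof -
  have "successively (\<lambda>x y. {x, y} \<in> E) p \<Longrightarrow> set (path_edges p) \<subseteq> E"
    by (induction p rule: induct_list012) auto
  then show "path_between V E u v p \<Longrightarrow> set (path_edges p) \<subseteq> E"
    by (simp add: path_between_def)
qed

lemma path_between_singleton [simp]: "path_between V E u v [x] \<longleftrightarrow> x \<in> V \<and> u = x \<and> v = x"
  by (auto simp: path_between_def)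

lemma path_between_ends:
  assumes "path_between V E u v p"
  shows "p \<noteq> []" "hd p = u" "last p = v" "u \<in> V" "v \<in> V"
  using assms by (auto simp: path_between_def)

lemma hop_join:
  assumes "path_between V E u v p" "path_between V E v x q"
  shows "hop (p @ tl q) = hop p + hop q"
  using assms by (simp add: hop_def path_edges_join path_between_def)

lemma hop_length: "hop p = length p - 1"
  by (simp add: hop_def path_edges_def)

text \<open>Cutting out the closed walk between two occurrences of a vertex keeps the ends and
  lowers the hop count. This is how the weight of a lightest walk gets a bound in terms of
  \<open>card V\<close> while the hop bound stays intact.\<close>

lemma path_between_shortcut:
  assumes "path_between V E u v p"
  obtains q where "path_between V E u v q" "hop q \<le> hop p" "distinct q"
proof -
  have "\<exists>q. path_between V E u v q \<and> hop q \<le> hop p \<and> distinct q"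
    using assms
  proof (induction "length p" arbitrary: p rule: less_induct)
    case less
    show ?case
    proof (cases "distinct p")
      case False
      then obtain xs ys zs y where p: "p = xs @ [y] @ ys @ [y] @ zs"
        using not_distinct_decomp by blast
      have "path_between V E u v (xs @ [y] @ zs)"
      proof -
        have "successively (\<lambda>x y. {x, y} \<in> E) (xs @ (y # ys) @ (y # zs))"
          using less.prems by (simp add: path_between_def p)
        then have "successively (\<lambda>x y. {x, y} \<in> E) (xs @ (y # zs))"
          unfolding successively_append_iff by (auto simp del: successively.simps)
        then show ?thesis
          using less.prems by (cases "xs = []") (auto simp: path_between_def p)
      qed
      moreover have "length (xs @ [y] @ zs) < length p"
        by (simp add: p)
      moreover have "hop (xs @ [y] @ zs) \<le> hop p"
        by (simp add: hop_length p)
      ultimately show ?thesis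
        using less.hyps by (meson order_trans)
    qed (use less in blast)
  qed
  with that show ?thesis by blast
qed

section \<open>Approximate minimax\<close>

lemma exp_le_one_plus_double:
  fixes x :: real
  assumes "0 \<le> x" "x \<le> 1"
  shows "exp x \<le> 1 + 2 * x"
proof -
  have "exp x \<le> 1 + x + x\<^sup>2"
    using assms exp_bound by blast
  moreover have "x\<^sup>2 \<le> x"
    using assms by (simp add: power2_eq_square mult_left_le)
  ultimately show ?thesis by linarith
qed

text \<open>Multiplicative weights.  Mixing with the uniform distribution bounds every payoff of a chosen
  \<open>a\<close> by \<open>2 * card I\<close>, which fixes the step size.\<close>

lemma approximate_minimax:
  fixes g :: "'a \<Rightarrow> 'i \<Rightarrow> real"
  assumes I: "finite I" "I \<noteq> {}"
    and nonneg: "\<And>a i. a \<in> A \<Longrightarrow> i \<in> I \<Longrightarrow> 0 \<le> g a i"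
    and response: "\<And>l. (\<And>i. i \<in> I \<Longrightarrow> 1 / (2 * card I) \<le> l i) \<Longrightarrow> (\<Sum>i\<in>I. l i) = 1 \<Longrightarrow>
      \<exists>a\<in>A. (\<Sum>i\<in>I. l i * g a i) \<le> 1"
  obtains as where "as \<noteq> []" "set as \<subseteq> A"
    "\<And>i. i \<in> I \<Longrightarrow> (\<Sum>a\<leftarrow>as. g a i) \<le> 6 * length as"
proof -
  define N where "N = real (card I)"
  have N: "N \<ge> 1"
    using I by (simp add: N_def Suc_leI card_gt_0_iff)
  define S where "S as i = (\<Sum>a\<leftarrow>as. g a i)" for as i
  define \<Phi> where "\<Phi> as = (\<Sum>i\<in>I. exp (S as i / (2 * N)))" for as
  have step: "\<exists>a\<in>A. \<Phi> (a # as) \<le> (1 + 2 / N) * \<Phi> as" for as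
  proof -
    define y where "y i = exp (S as i / (2 * N))" for i
    have y: "y i > 0" for i by (simp add: y_def)
    have \<Phi>: "\<Phi> as = sum y I" by (simp add: \<Phi>_def y_def)
    have pos: "sum y I > 0" using I y by (intro sum_pos) auto
    \<comment> \<open>Half multiplicative weights, half uniform distribution. The uniform half gives
      the lower bound demanded in \<open>response\<close>; the other half keeps every weight at
      least half of the normalised \<open>y i\<close>, which costs the factor \<open>2\<close> in
      \<open>yg\<close>.\<close>
    define l where "l i = (y i / sum y I + 1 / N) / 2" for i
    have l_ge: "1 / (2 * card I) \<le> l i" for i
      using pos y[of i] by (simp add: l_def N_def field_simps)
    have "(\<Sum>i\<in>I. y i / sum y I + 1 / N) = 1 + 1"
      using pos I N by (simp add: sum.distrib sum_divide_distrib[symmetric] N_def[symmetric])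
    then have "(\<Sum>i\<in>I. l i) = 1"
      unfolding l_def by (simp add: sum_divide_distrib[symmetric])
    then obtain a where a: "a \<in> A" "(\<Sum>i\<in>I. l i * g a i) \<le> 1"
      using response l_ge by blast
    have bd: "g a i \<le> 2 * N" if "i \<in> I" for i
    proof -
      have "1 / (2 * N) * g a i \<le> l i * g a i"
        using l_ge[of i] nonneg[OF a(1) that] by (intro mult_right_mono) (simp_all add: N_def)
      also have "\<dots> \<le> (\<Sum>i\<in>I. l i * g a i)"
      proof (intro member_le_sum)
        show "0 \<le> l x * g a x" if "x \<in> I - {i}" for x
          using that nonneg[OF a(1)] order_trans[OF _ l_ge, of 0 x] by simp
      qed (use I that in auto)
      also have "\<dots> \<le> 1" by (rule a(2))
      finally show ?thesis
        using N by (simp add: field_simps)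
    qed
    have "(\<Sum>i\<in>I. y i * g a i) / sum y I / 2 = (\<Sum>i\<in>I. (y i / sum y I / 2) * g a i)"
      by (simp add: sum_divide_distrib)
    also have "\<dots> \<le> (\<Sum>i\<in>I. l i * g a i)"
      using N nonneg[OF a(1)] by (intro sum_mono mult_right_mono) (auto simp: l_def field_simps)
    also have "\<dots> \<le> 1" by (rule a(2))
    finally have yg: "(\<Sum>i\<in>I. y i * g a i) \<le> 2 * sum y I"
      using pos by (simp add: field_simps)
    have "\<Phi> (a # as) = (\<Sum>i\<in>I. y i * exp (g a i / (2 * N)))"
      unfolding \<Phi>_def S_def y_def by (simp add: exp_add[symmetric] add_divide_distrib add.commute)
    also have "\<dots> \<le> (\<Sum>i\<in>I. y i * (1 + 2 * (g a i / (2 * N))))"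
      using bd nonneg[OF a(1)] N y
      by (intro sum_mono mult_left_mono exp_le_one_plus_double) (auto simp: less_imp_le)
    also have "\<dots> = sum y I + (\<Sum>i\<in>I. y i * g a i) / N"
      by (simp add: distrib_left sum.distrib sum_divide_distrib)
    also have "\<dots> \<le> sum y I + 2 * sum y I / N"
      using yg N by (simp add: divide_right_mono)
    also have "\<dots> = (1 + 2 / N) * \<Phi> as"
      by (simp add: \<Phi> algebra_simps)
    finally show ?thesis using a(1) by blast
  qed
  have "\<exists>as. length as = T \<and> set as \<subseteq> A \<and> \<Phi> as \<le> N * (1 + 2 / N) ^ T" for T
  proof (induction T)
    case 0
    show ?case by (intro exI[of _ "[]"]) (simp add: \<Phi>_def S_def N_def)
  next
    case (Suc T)
    then obtain as where as: "length as = T" "set as \<subseteq> A" "\<Phi> as \<le> N * (1 + 2 / N) ^ T"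
      by blast
    obtain a where a: "a \<in> A" "\<Phi> (a # as) \<le> (1 + 2 / N) * \<Phi> as"
      using step by blast
    have "(1 + 2 / N) * \<Phi> as \<le> (1 + 2 / N) * (N * (1 + 2 / N) ^ T)"
      using as N by (intro mult_left_mono) auto
    with a as show ?case
      by (intro exI[of _ "a # as"]) (auto simp: mult.assoc mult.left_commute)
  qed
  \<comment> \<open>After \<open>T\<close> rounds the logarithm of the potential is at most
    \<open>ln N + T * (2 / N)\<close>. A total payoff is then at most
    \<open>2 * (N * ln N) + 4 * T\<close>, and \<open>T\<close> at least \<open>N * ln N\<close>
    brings this to \<open>6 * T\<close>. \<open>Suc\<close> keeps the list nonempty for
    \<open>N = 1\<close>.\<close>
  moreover define T where "T = Suc (nat \<lceil>N * ln N\<rceil>)"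
  ultimately obtain as where as: "length as = T" "set as \<subseteq> A" "\<Phi> as \<le> N * (1 + 2 / N) ^ T"
    by blast
  have T: "N * ln N \<le> T"
    unfolding T_def by linarith
  have "S as i \<le> 6 * T" if "i \<in> I" for i
  proof -
    have "exp (S as i / (2 * N)) \<le> \<Phi> as"
      unfolding \<Phi>_def by (rule member_le_sum[OF that]) (auto simp: I)
    also have "\<dots> \<le> N * exp (2 / N) ^ T"
      using as(3) N by (elim order_trans) (intro mult_left_mono power_mono; simp)
    also have "\<dots> = exp (ln N + T * (2 / N))"
      using N by (simp add: exp_add flip: exp_of_nat_mult)
    finally have "S as i / (2 * N) \<le> ln N + T * (2 / N)"
      by simp
    then have "S as i \<le> 2 * (N * ln N) + 4 * T"
      using N by (simp add: field_simps)
    with T show ?thesis by linarith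
  qed
  then show ?thesis
    using as by (intro that[of as]) (auto simp: S_def T_def)
qed

section \<open>Sparse partitions\<close>

text \<open>Region growing.  The weight counted at a vertex \<open>v\<close> is charged only when the last part of
  \<open>N v\<close> is carved away, so that vertices lying in earlier clusters cause no extra cost.\<close>

lemma sparse_partition:
  fixes N :: "'v \<Rightarrow> 'v set" and \<mu> :: "'v \<Rightarrow> real"
  assumes V: "finite V" and NV: "\<And>v. v \<in> V \<Longrightarrow> N v \<subseteq> V"
    and refl: "\<And>v. v \<in> V \<Longrightarrow> v \<in> N v"
    and sym: "\<And>u v. u \<in> V \<Longrightarrow> v \<in> N u \<Longrightarrow> u \<in> N v"
    and \<mu>: "\<And>v. v \<in> V \<Longrightarrow> 0 \<le> \<mu> v"
    and \<epsilon>: "0 \<le> \<epsilon>" and M: "real (card V) \<le> (1 + \<epsilon>) ^ M"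
  obtains cl where
    "\<And>v. v \<in> V \<Longrightarrow> (cl v, v) \<in> {(x, y). x \<in> V \<and> y \<in> N x} ^^ (2 * M + 3)"
    "(\<Sum>v\<in>V. \<mu> v * card (cl ` N v)) \<le> (1 + \<epsilon>) * (\<Sum>v\<in>V. \<mu> v)"
proof -
  define r where "r = {(x, y). x \<in> V \<and> y \<in> N x}"
  have r_mono: "(x, y) \<in> r ^^ l" if "(x, y) \<in> r ^^ k" "k \<le> l" "y \<in> V" for x y k l
    using that(2)
  proof (induction l rule: dec_induct)
    case (step n)
    then show ?case using that(3) refl by (auto simp: r_def)
  qed (use that in auto)
  define H where "H U = {v\<in>V. N v \<inter> U \<noteq> {}}" for U
  have fin [simp]: "finite (H U)" for U using V by (simp add: H_def)
  have H_mono: "H A \<subseteq> H B" if "A \<subseteq> B" for A B using that by (auto simp: H_def)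
  have mono: "sum \<mu> (H A) \<le> sum \<mu> (H B)" if "A \<subseteq> B" for A B
    using H_mono[OF that] \<mu> V by (intro sum_mono2) (auto simp: H_def)
  \<comment> \<open>Induction over the set \<open>U\<close> of vertices not yet clustered.
    \<open>H U\<close> collects the vertices whose neighbourhood still meets \<open>U\<close>; only
    their weight is left to be charged.\<close>
  have "\<exists>cl. (\<forall>v\<in>U. (cl v, v) \<in> r ^^ (2 * M + 3)) \<and>
      (\<Sum>v\<in>V. \<mu> v * card (cl ` (N v \<inter> U))) \<le> (1 + \<epsilon>) * sum \<mu> (H U)" if "U \<subseteq> V" for U
    using that
  proof (induction "card U" arbitrary: U rule: less_induct)
    case less
    have finU: "finite U" using less.prems V finite_subset by blast
    show ?case
    proof (cases "U = {}")
      case True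
      then show ?thesis by (simp add: H_def)
    next
      case False
      have "H U \<noteq> {}" using False less.prems refl by (force simp: H_def)
      \<comment> \<open>The seed is a heaviest vertex of \<open>H U\<close>: then \<open>H U\<close>
        weighs at most \<open>card V * \<mu> z\<close>, and growth by more than the factor
        \<open>1 + \<epsilon>\<close> must fail in one of the rounds \<open>0\<close> to
        \<open>M\<close>.\<close>
      then obtain z where z: "z \<in> H U" "\<And>v. v \<in> H U \<Longrightarrow> \<mu> v \<le> \<mu> z"
        using Max_in[of "\<mu> ` H U"] Max_ge[of "\<mu> ` H U"] by fastforce
      have zV: "z \<in> V" using z by (simp add: H_def)
      \<comment> \<open>One round goes from a vertex of the ball to a vertex of \<open>H\<close> and
        on to one of its neighbours, which is two steps of \<open>r\<close>. With the first step
        this makes \<open>2 * m + 1\<close>, and \<open>2 * M + 3\<close> for the last possible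
        cluster \<open>C (Suc M)\<close>.\<close>
      define C where "C = rec_nat (N z \<inter> U) (\<lambda>_ B. U \<inter> (\<Union>v\<in>H B. N v))"
      have C0: "C 0 = N z \<inter> U" and CSuc: "C (Suc m) = U \<inter> (\<Union>v\<in>H (C m). N v)" for m
        by (simp_all add: C_def)
      have CU: "C m \<subseteq> U" for m by (cases m) (auto simp: C0 CSuc)
      have C_mono: "C m \<subseteq> C (Suc m)" for m
        using CU[of m] less.prems refl by (fastforce simp: CSuc H_def)
      have C0_sub: "C 0 \<subseteq> C m" for m by (induction m) (use C_mono in blast)+
      have C_reach: "(z, u) \<in> r ^^ (2 * m + 1)" if "u \<in> C m" for u m
        using that
      proof (induction m arbitrary: u)
        case 0
        then show ?case using zV by (auto simp: C0 r_def)
      next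
        case (Suc m)
        then obtain v x where v: "v \<in> V" "x \<in> N v" "x \<in> C m" "u \<in> N v"
          by (auto simp: CSuc H_def)
        have "(x, v) \<in> r" "(v, u) \<in> r"
          using v sym NV by (auto simp: r_def)
        then show ?case
          using Suc.IH[OF v(3)] by (auto simp: relcomp_unfold)
      qed
      have "\<exists>m\<le>M. sum \<mu> (H (C (Suc m))) \<le> (1 + \<epsilon>) * sum \<mu> (H (C m))"
      proof (rule ccontr)
        assume "\<not> ?thesis"
        then have grow: "(1 + \<epsilon>) * sum \<mu> (H (C m)) < sum \<mu> (H (C (Suc m)))" if "m \<le> M" for m
          using that by force
        have "(1 + \<epsilon>) ^ m * \<mu> z \<le> sum \<mu> (H (C m))" if "m \<le> M" for m
          using that
        proof (induction m)
          case 0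
          have "z \<in> H (C 0)" using z by (auto simp: C0 H_def)
          then show ?case using \<mu> by (auto intro!: member_le_sum simp: H_def V)
        next
          case (Suc m)
          then have "(1 + \<epsilon>) * ((1 + \<epsilon>) ^ m * \<mu> z) \<le> (1 + \<epsilon>) * sum \<mu> (H (C m))"
            using \<epsilon> by (intro mult_left_mono) auto
          then show ?case using grow[of m] Suc.prems by (simp add: mult.assoc)
        qed
        from this[of M] have "card V * \<mu> z \<le> sum \<mu> (H (C M))"
          using mult_right_mono[OF M, of "\<mu> z"] \<mu>[OF zV] by linarith
        also have "\<dots> \<le> (1 + \<epsilon>) * sum \<mu> (H (C M))"
          using \<epsilon> mult_right_mono[of 1 "1 + \<epsilon>" "sum \<mu> (H (C M))"] sum_nonneg[of "H (C M)" \<mu>] \<mu>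
          by (auto simp: H_def)
        also have "\<dots> < sum \<mu> (H (C (Suc M)))"
          by (rule grow) simp
        also have "\<dots> \<le> sum \<mu> (H U)"
          by (rule mono[OF CU])
        also have "\<dots> \<le> card (H U) * \<mu> z"
          using z by (intro sum_bounded_above) auto
        also have "\<dots> \<le> card V * \<mu> z"
          using V \<mu>[OF zV] by (intro mult_right_mono) (auto intro!: card_mono simp: H_def)
        finally show False by simp
      qed
      then obtain m where m: "m \<le> M" "sum \<mu> (H (C (Suc m))) \<le> (1 + \<epsilon>) * sum \<mu> (H (C m))"
        by blast
      \<comment> \<open>The cluster is \<open>C (Suc m)\<close> and not \<open>C m\<close>: every
        \<open>v\<close> in \<open>H (C m)\<close> has \<open>N v \<inter> U\<close> inside it, so
        \<open>H (C m)\<close> and \<open>H (U - B)\<close> are disjoint. Slow growth charges the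
        weight of \<open>H B\<close> to \<open>H (C m)\<close>, and the sets charged for different
        clusters never overlap.\<close>
      define B where "B = C (Suc m)"
      have "N z \<inter> U \<noteq> {}" using z by (auto simp: H_def)
      then have "U - B \<subset> U" using C0_sub[of "Suc m"] by (auto simp: B_def C0)
      then obtain cl where cl: "\<And>v. v \<in> U - B \<Longrightarrow> (cl v, v) \<in> r ^^ (2 * M + 3)"
        "(\<Sum>v\<in>V. \<mu> v * card (cl ` (N v \<inter> (U - B)))) \<le> (1 + \<epsilon>) * sum \<mu> (H (U - B))"
        using less.hyps[of "U - B"] less.prems finU psubset_card_mono by blast
      define cl' where "cl' v = (if v \<in> B then z else cl v)" for v
      have reach: "(cl' v, v) \<in> r ^^ (2 * M + 3)" if "v \<in> U" for v
      proof (cases "v \<in> B")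
        case True
        then have "(z, v) \<in> r ^^ (2 * Suc m + 1)"
          using C_reach[of v "Suc m"] unfolding B_def by blast
        then show ?thesis
          using True r_mono[of z v "2 * Suc m + 1" "2 * M + 3"] m(1) that less.prems
          by (auto simp: cl'_def)
      qed (use that cl in \<open>auto simp: cl'_def\<close>)
      have count: "\<mu> v * card (cl' ` (N v \<inter> U)) \<le>
          (if v \<in> H B then \<mu> v else 0) + \<mu> v * card (cl ` (N v \<inter> (U - B)))" if "v \<in> V" for v
      proof -
        have f: "finite (N v \<inter> A)" for A using V NV that finite_subset by blast
        have "cl' ` (N v \<inter> U) \<subseteq> (if v \<in> H B then {z} else {}) \<union> cl ` (N v \<inter> (U - B))"
          using that by (auto simp: cl'_def H_def)
        then have "card (cl' ` (N v \<inter> U)) \<le>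
            card ((if v \<in> H B then {z} else {}) \<union> cl ` (N v \<inter> (U - B)))"
          using f by (intro card_mono) auto
        also have "\<dots> \<le> (if v \<in> H B then 1 else 0) + card (cl ` (N v \<inter> (U - B)))"
          by (rule order_trans[OF card_Un_le]) auto
        finally have "\<mu> v * card (cl' ` (N v \<inter> U)) \<le>
            \<mu> v * ((if v \<in> H B then 1 else 0) + card (cl ` (N v \<inter> (U - B))))"
          using \<mu>[OF that] by (intro mult_left_mono) auto
        then show ?thesis by (auto simp: algebra_simps)
      qed
      have "(\<Sum>v\<in>V. \<mu> v * card (cl' ` (N v \<inter> U))) \<le>
          (\<Sum>v\<in>V. if v \<in> H B then \<mu> v else 0) + (\<Sum>v\<in>V. \<mu> v * card (cl ` (N v \<inter> (U - B))))"
        unfolding sum.distrib[symmetric] by (intro sum_mono count)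
      also have "(\<Sum>v\<in>V. if v \<in> H B then \<mu> v else 0) = sum \<mu> (H B)"
        using V by (simp add: sum.If_cases) (auto intro!: sum.cong simp: H_def)
      also have "sum \<mu> (H B) + (\<Sum>v\<in>V. \<mu> v * card (cl ` (N v \<inter> (U - B)))) \<le>
          (1 + \<epsilon>) * (sum \<mu> (H (C m)) + sum \<mu> (H (U - B)))"
        using m(2) cl(2) by (simp add: B_def distrib_left)
      also have "sum \<mu> (H (C m)) + sum \<mu> (H (U - B)) = sum \<mu> (H (C m) \<union> H (U - B))"
        by (rule sum.union_disjoint[symmetric, OF fin fin]) (auto simp: H_def B_def CSuc)
      also have "(1 + \<epsilon>) * \<dots> \<le> (1 + \<epsilon>) * sum \<mu> (H U)"
        using \<epsilon> \<mu> V CU[of m] by (intro mult_left_mono sum_mono2) (auto simp: H_def)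
      finally show ?thesis using reach by blast
    qed
  qed
  from this[of V] obtain cl where cl: "\<And>v. v \<in> V \<Longrightarrow> (cl v, v) \<in> r ^^ (2 * M + 3)"
    "(\<Sum>v\<in>V. \<mu> v * card (cl ` (N v \<inter> V))) \<le> (1 + \<epsilon>) * sum \<mu> (H V)"
    by blast
  have "N v \<inter> V = N v" if "v \<in> V" for v using NV that by blast
  moreover have "H V = V" using refl by (auto simp: H_def)
  ultimately show ?thesis using cl that[of cl] by (simp add: r_def)
qed

section \<open>Weighted walks with few hops\<close>

definition path_weight :: "('v set \<Rightarrow> real) \<Rightarrow> 'v list \<Rightarrow> real" where
  "path_weight w p = (\<Sum>e\<leftarrow>path_edges p. w e)"

lemma path_weight_rev: "path_weight w (rev p) = path_weight w p"
  by (simp add: path_weight_def path_edges_rev rev_map[symmetric] sum_list_rev)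

lemma hop_rev: "hop (rev p) = hop p"
  by (simp add: hop_length)

lemma path_weight_join:
  assumes "path_between V E u v p" "path_between V E v x q"
  shows "path_weight w (p @ tl q) = path_weight w p + path_weight w q"
  using assms by (simp add: path_weight_def path_edges_join path_between_def)

lemma sum_list_eq_sum_count_list:
  assumes "finite E" "set xs \<subseteq> E"
  shows "(\<Sum>x\<leftarrow>xs. f x) = (\<Sum>x\<in>E. real (count_list xs x) * f x)"
  using assms(2)
proof (induction xs)
  case (Cons y xs)
  have "(\<Sum>x\<in>E. real (count_list (y # xs) x) * f x) =
      (\<Sum>x\<in>E. (if x = y then f x else 0) + real (count_list xs x) * f x)"
    by (intro sum.cong) (auto simp: algebra_simps)
  then show ?case
    using Cons assms(1) by (simp add: sum.distrib)
qed simp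

lemma path_weight_eq_sum:
  assumes "finite E" "set (path_edges p) \<subseteq> E"
  shows "path_weight w p = (\<Sum>e\<in>E. real (count_list (path_edges p) e) * w e)"
  unfolding path_weight_def using assms by (rule sum_list_eq_sum_count_list)

section \<open>Edge sums and vertex sums\<close>

context capacitated_graph begin

lemma finite_edges: "finite E"
proof (rule finite_subset)
  show "E \<subseteq> Pow V" using edge_ends by blast
qed (simp add: finite_vertices)

text \<open>An edge meeting \<open>N\<close> is counted on the right at one of its ends at least.
  Region growing weighs vertices, so the volume of edges has to be carried over to their ends;
  \<open>vertex_sum_eq\<close> shows that this only doubles the total.\<close>

lemma edge_sum_le_vertex_sum:
  assumes "\<And>e. e \<in> E \<Longrightarrow> 0 \<le> f e" "N \<subseteq> V"
  shows "(\<Sum>e | e \<in> E \<and> e \<inter> N \<noteq> {}. f e) \<le> (\<Sum>v\<in>N. \<Sum>e | e \<in> E \<and> v \<in> e. (f e :: real))"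
proof -
  have fin: "finite N" using assms(2) finite_vertices finite_subset by blast
  have "(\<Sum>e | e \<in> E \<and> e \<inter> N \<noteq> {}. f e) \<le> (\<Sum>e\<in>E. \<Sum>v\<in>N. if v \<in> e then f e else 0)"
  proof -
    have "f e \<le> (\<Sum>v\<in>N. if v \<in> e then f e else 0)" if e: "e \<in> E" "e \<inter> N \<noteq> {}" for e
    proof -
      obtain v where v: "v \<in> e" "v \<in> N" using e(2) by blast
      have "(if v \<in> e then f e else 0) \<le> (\<Sum>v\<in>N. if v \<in> e then f e else 0)"
        using fin v assms(1)[OF e(1)] by (intro member_le_sum) auto
      with v show ?thesis by simp
    qed
    then have "(\<Sum>e | e \<in> E \<and> e \<inter> N \<noteq> {}. f e) \<le>
        (\<Sum>e | e \<in> E \<and> e \<inter> N \<noteq> {}. \<Sum>v\<in>N. if v \<in> e then f e else 0)"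
      by (intro sum_mono) auto
    also have "\<dots> \<le> (\<Sum>e\<in>E. \<Sum>v\<in>N. if v \<in> e then f e else 0)"
      using assms finite_edges by (intro sum_mono2) (auto intro!: sum_nonneg)
    finally show ?thesis .
  qed
  also have "\<dots> = (\<Sum>v\<in>N. \<Sum>e\<in>E. if v \<in> e then f e else 0)"
    by (rule sum.swap)
  also have "\<dots> = (\<Sum>v\<in>N. \<Sum>e | e \<in> E \<and> v \<in> e. f e)"
    using finite_edges by (simp add: sum.inter_filter)
  finally show ?thesis .
qed

lemma vertex_sum_eq:
  "(\<Sum>v\<in>V. \<Sum>e | e \<in> E \<and> v \<in> e. f e) = 2 * (\<Sum>e\<in>E. f e :: real)"
proof -
  have "(\<Sum>v\<in>V. \<Sum>e | e \<in> E \<and> v \<in> e. f e) = (\<Sum>v\<in>V. \<Sum>e\<in>E. if v \<in> e then f e else 0)"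
    using finite_edges by (simp add: sum.inter_filter)
  also have "\<dots> = (\<Sum>e\<in>E. \<Sum>v\<in>V. if v \<in> e then f e else 0)"
    by (rule sum.swap)
  also have "\<dots> = (\<Sum>e\<in>E. 2 * f e)"
  proof (rule sum.cong)
    fix e assume "e \<in> E"
    then obtain u v where e: "u \<in> V" "v \<in> V" "u \<noteq> v" "e = {u, v}" using edge_ends by blast
    have "(\<Sum>v\<in>V. if v \<in> e then f e else 0) = (\<Sum>v\<in>{v\<in>V. v \<in> e}. f e)"
      using finite_vertices by (simp add: sum.inter_filter del: sum_constant)
    also have "{v\<in>V. v \<in> e} = {u, v}" using e by auto
    finally show "(\<Sum>v\<in>V. if v \<in> e then f e else 0) = 2 * f e" using e by simp
  qed simp
  finally show ?thesis by (simp add: sum_distrib_left)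
qed

end

text \<open>The hop bound stays \<open>h\<close> at every weight, so there is no triangle
  inequality: concatenation adds the hops. Distances to a centre are therefore counted in steps of
  this relation, and each step may cost \<open>h\<close> hops.\<close>

definition near :: "'v set \<Rightarrow> 'v set set \<Rightarrow> ('v set \<Rightarrow> real) \<Rightarrow> nat \<Rightarrow> real \<Rightarrow> 'v \<Rightarrow> 'v \<Rightarrow> bool" where
  "near V E w h \<rho> u v \<longleftrightarrow> (\<exists>p. path_between V E u v p \<and> hop p \<le> h \<and> path_weight w p \<le> \<rho>)"

lemma near_refl: "u \<in> V \<Longrightarrow> 0 \<le> \<rho> \<Longrightarrow> near V E w h \<rho> u u"
  unfolding near_def by (intro exI[of _ "[u]"]) (simp add: hop_def path_weight_def)

lemma near_sym: "near V E w h \<rho> u v \<Longrightarrow> near V E w h \<rho> v u"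
  unfolding near_def by (metis path_between_rev hop_rev path_weight_rev)

lemma near_mono: "near V E w h \<rho> u v \<Longrightarrow> \<rho> \<le> \<rho>' \<Longrightarrow> near V E w h \<rho>' u v"
  unfolding near_def by force

lemma near_ends: "near V E w h \<rho> u v \<Longrightarrow> u \<in> V \<and> v \<in> V"
  unfolding near_def by (blast dest: path_between_ends)

text \<open>One walk per step, concatenated. The power with exponent \<open>0\<close> is the
  identity on the whole type, which is why \<open>v\<close> is required to be a vertex.\<close>

lemma relpow_near_path:
  assumes "(u, v) \<in> {(x, y). x \<in> V \<and> near V E w h \<rho> x y} ^^ k" "v \<in> V"
  obtains p where "path_between V E u v p" "hop p \<le> k * h" "path_weight w p \<le> k * \<rho>"
proof -
  have "\<exists>p. path_between V E u v p \<and> hop p \<le> k * h \<and> path_weight w p \<le> k * \<rho>"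
    using assms
  proof (induction k arbitrary: v)
    case 0
    then show ?case
      by (intro exI[of _ "[u]"]) (simp add: hop_def path_weight_def)
  next
    case (Suc k)
    then obtain x where x: "(u, x) \<in> {(x, y). x \<in> V \<and> near V E w h \<rho> x y} ^^ k"
      "x \<in> V" "near V E w h \<rho> x v"
      by (auto simp: relcomp_unfold)
    obtain p where p: "path_between V E u x p" "hop p \<le> k * h" "path_weight w p \<le> k * \<rho>"
      using Suc.IH x by blast
    obtain q where q: "path_between V E x v q" "hop q \<le> h" "path_weight w q \<le> \<rho>"
      using x(3) by (auto simp: near_def)
    show ?case
      using p q path_between_join[OF p(1) q(1)] hop_join[OF p(1) q(1)] path_weight_join[OF p(1) q(1)]
      by (intro exI[of _ "p @ tl q"]) (auto simp: algebra_simps)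
  qed
  with that show ?thesis by blast
qed

text \<open>Cut \<open>p\<close> at its first vertex outside \<open>N\<close>: all edges before that vertex meet \<open>N\<close>.\<close>

lemma weight_inside_neighbourhood:
  assumes p: "path_between V E u v p" "hop p \<le> h" and w: "\<And>e. e \<in> E \<Longrightarrow> 0 \<le> w e"
    and far: "\<delta> \<le> path_weight w p"
    and N: "\<And>x. near V E w h \<delta> u x \<Longrightarrow> x \<in> N"
  shows "\<delta> \<le> (\<Sum>e\<leftarrow>filter (\<lambda>e. e \<inter> N \<noteq> {}) (path_edges p). w e)"
proof -
  have "\<exists>q r. p = q @ r \<and> q \<noteq> [] \<and> set (path_edges q) \<subseteq> {e. e \<inter> N \<noteq> {}} \<and>
      \<delta> \<le> path_weight w q"
  proof (cases "set p \<subseteq> N")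
    case True
    have "set (path_edges p) \<subseteq> {e. e \<inter> N \<noteq> {}}"
      using True by (auto simp: path_edges_def dest: set_zip_leftD)
    with far p show ?thesis by (intro exI[of _ p] exI[of _ "[]"]) (auto simp: path_between_def)
  next
    case False
    then obtain ys x zs where split: "p = ys @ x # zs" "x \<notin> N" "set ys \<subseteq> N"
      using split_list_first_prop[of p "\<lambda>x. x \<notin> N"] by blast
    have walk: "path_between V E u x (ys @ [x])"
      using p(1) split(1) by (cases "ys = []") (auto simp: path_between_def successively_append_iff)
    have "hop (ys @ [x]) \<le> h"
      using p(2) by (simp add: split(1) hop_length)
    \<comment> \<open>The prefix ends outside \<open>N\<close>, so its end is not near
      \<open>u\<close>. As it has at most \<open>h\<close> hops, its weight must exceed
      \<open>\<delta>\<close>.\<close>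
    then have "\<delta> \<le> path_weight w (ys @ [x])"
      using N walk split(2) unfolding near_def by fastforce
    moreover have "set (path_edges (ys @ [x])) \<subseteq> {e. e \<inter> N \<noteq> {}}"
      using split(3)
    proof (induction ys rule: induct_list012)
      case (3 a b ys)
      then show ?case by auto
    qed auto
    ultimately show ?thesis
      by (intro exI[of _ "ys @ [x]"] exI[of _ zs]) (auto simp: split(1))
  qed
  then obtain q r where q: "p = q @ r" "q \<noteq> []" "set (path_edges q) \<subseteq> {e. e \<inter> N \<noteq> {}}"
    "\<delta> \<le> path_weight w q"
    by blast
  have pe: "path_edges p = path_edges q @ path_edges (last q # r)"
    using path_edges_join[of q "last q # r"] q by simp
  have "filter (\<lambda>e. e \<inter> N \<noteq> {}) (path_edges q) = path_edges q"
    using q(3) by (auto simp: filter_id_conv)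
  moreover have "0 \<le> (\<Sum>e\<leftarrow>filter (\<lambda>e. e \<inter> N \<noteq> {}) (path_edges (last q # r)). w e)"
    using path_between_edges[OF p(1)] w by (intro sum_list_nonneg) (auto simp: pe)
  ultimately show ?thesis
    using q(4) by (simp add: pe path_weight_def)
qed

text \<open>Reversal reduces the second end to the first. Multiplicities summed over the edge set
  replace the list of edges, so that expectations over a random walk can be taken edge by
  edge.\<close>

lemma weight_inside_neighbourhood_ends:
  assumes p: "path_between V E u v p" "hop p \<le> h" and w: "\<And>e. e \<in> E \<Longrightarrow> 0 \<le> w e"
    and far: "\<not> near V E w h \<delta> u v" and x: "x = u \<or> x = v"
    and N: "\<And>y. near V E w h \<delta> x y \<Longrightarrow> y \<in> N" and E: "finite E"
  shows "\<delta> \<le> (\<Sum>e | e \<in> E \<and> e \<inter> N \<noteq> {}. real (count_list (path_edges p) e) * w e)"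
proof -
  have far: "\<delta> \<le> path_weight w p"
    using far p unfolding near_def by fastforce
  have eq: "(\<Sum>e\<leftarrow>filter (\<lambda>e. e \<inter> N \<noteq> {}) (path_edges p). w e) =
    (\<Sum>e | e \<in> E \<and> e \<inter> N \<noteq> {}. real (count_list (path_edges p) e) * w e)"
  proof -
    have "(\<Sum>e\<leftarrow>filter (\<lambda>e. e \<inter> N \<noteq> {}) (path_edges p). w e) =
       (\<Sum>e\<leftarrow>path_edges p. if e \<inter> N \<noteq> {} then w e else 0)"
      by (simp add: sum_list_map_filter')
    also have "\<dots> = (\<Sum>e\<in>E. real (count_list (path_edges p) e) * (if e \<inter> N \<noteq> {} then w e else 0))"
      using E path_between_edges[OF p(1)] by (rule sum_list_eq_sum_count_list)
    also have "\<dots> = (\<Sum>e\<in>E. if e \<inter> N \<noteq> {} then real (count_list (path_edges p) e) * w e else 0)"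
      by (intro sum.cong) auto
    finally show ?thesis using E by (simp add: sum.inter_filter)
  qed
  show ?thesis
  proof (cases "x = u")
    case True
    then show ?thesis
      using weight_inside_neighbourhood[OF p w far, of N] N eq by simp
  next
    case False
    then have "x = v" using x by simp
    have "(\<Sum>e\<leftarrow>filter (\<lambda>e. e \<inter> N \<noteq> {}) (path_edges (rev p)). w e) =
        (\<Sum>e\<leftarrow>filter (\<lambda>e. e \<inter> N \<noteq> {}) (path_edges p). w e)"
      by (simp add: path_edges_rev rev_filter[symmetric] rev_map[symmetric] sum_list_rev)
    then show ?thesis
      using weight_inside_neighbourhood[where h = h and w = w and \<delta> = \<delta> and N = N,
          OF path_between_rev[OF p(1)] _ w] p(2) far
        N eq \<open>x = v\<close>
      by (simp add: hop_rev path_weight_rev)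
  qed
qed

section \<open>Partitions at all scales\<close>

text \<open>Level \<open>k\<close> has radius \<open>2 ^ k * \<rho>\<close>. Level \<open>0\<close>
  is too small for any edge, by \<open>w_gt\<close>, and level \<open>J\<close> reaches every pair
  that \<open>h\<close> hops can join. \<open>M\<close> bounds the growing rounds of
  \<open>sparse_partition\<close>, and the upper bound on \<open>\<epsilon>\<close> allows the total
  spread to be absorbed in \<open>partitions\<close>.\<close>

locale weighted_levels = capacitated_graph V E c
  for V :: "'v set" and E c +
  fixes w :: "'v set \<Rightarrow> real" and h :: nat and \<rho> \<epsilon> :: real and M J :: nat
  assumes \<rho>_pos: "0 < \<rho>" and w_gt: "e \<in> E \<Longrightarrow> \<rho> < w e"
    and \<epsilon>: "0 \<le> \<epsilon>" "\<epsilon> \<le> 1 / 10" and M: "real (card V) \<le> (1 + \<epsilon>) ^ M" and J: "J \<ge> 1"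
    and top: "u \<in> V \<Longrightarrow> path_between V E u v p \<Longrightarrow> hop p \<le> h \<Longrightarrow> near V E w h (2 ^ J * \<rho>) u v"
begin

definition N :: "nat \<Rightarrow> 'v \<Rightarrow> 'v set" where
  "N k u = {v. near V E w h (2 ^ k * \<rho>) u v}"

definition pairs :: "('v \<times> 'v) set" where
  "pairs = {(s, t). s \<noteq> t \<and> t \<in> N J s}"

definition scale :: "'v \<Rightarrow> 'v \<Rightarrow> nat" where
  "scale s t = (LEAST k. t \<in> N k s)"

lemma w_pos: "e \<in> E \<Longrightarrow> 0 < w e"
  using w_gt \<rho>_pos by fastforce

lemma N_sub: "N k u \<subseteq> V" using near_ends by (fastforce simp: N_def)

lemma finite_N [simp]: "finite (N k u)" using N_sub finite_vertices finite_subset by blast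

lemma N_refl: "u \<in> V \<Longrightarrow> u \<in> N k u"
  using \<rho>_pos by (simp add: N_def near_refl)

lemma N_sym: "v \<in> N k u \<Longrightarrow> u \<in> N k v"
  by (simp add: N_def near_sym)

lemma N_mono: "k \<le> l \<Longrightarrow> N k u \<subseteq> N l u"
  using \<rho>_pos by (auto simp: N_def elim!: near_mono)

text \<open>Every edge outweighs \<open>\<rho>\<close>, which leaves only the walk without hops. The
  levels can thus start with each vertex as its own cluster, and the scale of a pair is
  positive.\<close>

lemma N_zero: "N 0 u \<subseteq> {u}"
proof
  fix v assume "v \<in> N 0 u"
  then obtain p where p: "path_between V E u v p" "path_weight w p \<le> \<rho>"
    by (auto simp: N_def near_def)
  have "path_edges p = []"
  proof (rule ccontr)
    assume "path_edges p \<noteq> []"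
    then obtain e es where es: "path_edges p = e # es" by (cases "path_edges p") auto
    have "0 \<le> (\<Sum>e\<leftarrow>es. w e)"
      using path_between_edges[OF p(1)] w_pos by (intro sum_list_nonneg) (auto simp: es less_imp_le)
    moreover have "\<rho> < w e"
      using path_between_edges[OF p(1)] w_gt by (auto simp: es)
    ultimately show False
      using p(2) by (simp add: path_weight_def es)
  qed
  then have "tl p = []" using path_between_ends(1)[OF p(1)] by (cases p) (auto simp: path_edges_def)
  then show "v \<in> {u}"
    using p(1) by (cases p) (auto simp: path_between_def)
qed

lemma pairs_sub: "pairs \<subseteq> V \<times> V"
  using N_sub N_sym by (fastforce simp: pairs_def)

lemma finite_pairs: "finite pairs"
  using pairs_sub finite_vertices finite_subset by blast

lemma scale_props:
  assumes "(s, t) \<in> pairs"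
  shows "t \<in> N (scale s t) s" "scale s t \<le> J" "0 < scale s t" "k < scale s t \<Longrightarrow> t \<notin> N k s"
proof -
  have "t \<in> N J s" and ne: "s \<noteq> t" using assms by (auto simp: pairs_def)
  then show *: "t \<in> N (scale s t) s" "scale s t \<le> J" "k < scale s t \<Longrightarrow> t \<notin> N k s"
    unfolding scale_def by (auto intro: LeastI Least_le dest: not_less_Least)
  show "0 < scale s t"
    using *(1) ne N_zero by (metis gr0I singletonD subsetD)
qed

definition spread :: "(nat \<Rightarrow> 'v \<Rightarrow> 'v) \<Rightarrow> nat \<Rightarrow> 'v \<Rightarrow> real" where
  "spread cl k v = card (cl k ` N k v)"

lemma spread_ge_one: "v \<in> V \<Longrightarrow> 1 \<le> spread cl k v"
  unfolding spread_def using N_refl by (fastforce simp: Suc_le_eq card_gt_0_iff)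

text \<open>The neighbourhood of \<open>s\<close> meets the clusters of both \<open>s\<close> and
  \<open>t\<close>. A separated pair thus contributes at least \<open>1\<close> to the excess of the
  spread over its minimum \<open>1\<close>, and a bound on the excess limits the weight of separated
  pairs.\<close>

lemma separated_imp_spread:
  assumes "t \<in> N k s" "cl k s \<noteq> cl k t"
  shows "2 \<le> spread cl k s"
proof -
  have "s \<in> V" using assms(1) N_sub N_sym by blast
  then have "{cl k s, cl k t} \<subseteq> cl k ` N k s" using assms(1) N_refl by auto
  then have "card {cl k s, cl k t} \<le> card (cl k ` N k s)" by (intro card_mono) auto
  then show ?thesis using assms(2) by (simp add: spread_def)
qed

definition reach :: "nat \<Rightarrow> ('v \<times> 'v) set" where
  "reach k = {(x, y). x \<in> V \<and> y \<in> N k x} ^^ (2 * M + 3)"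

text \<open>The partitions of different levels are not nested.  In the weight of level \<open>k + 1\<close>, the summand
  \<open>spread cl k v\<close> controls the common refinement with level \<open>k\<close>, and the summand \<open>1\<close> keeps the
  bounds from compounding over the levels.\<close>

lemma partitions:
  fixes vol :: "'v \<Rightarrow> real" and q :: "'v \<times> 'v \<Rightarrow> real"
  assumes vol: "\<And>v. v \<in> V \<Longrightarrow> 0 \<le> vol v" "sum vol V \<le> 2"
    and q: "\<And>x. x \<in> pairs \<Longrightarrow> 0 \<le> q x" "sum q pairs \<le> 1"
  obtains cl where
    "\<And>v. cl 0 v = v" "\<And>k v. v \<in> V \<Longrightarrow> (cl k v, v) \<in> reach k"
    "(\<Sum>k<J. \<Sum>v\<in>V. vol v * spread cl k v * spread cl (Suc k) v) \<le> 8 * real J"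
    "(\<Sum>(s, t)\<in>{(s, t)\<in>pairs. cl (scale s t) s \<noteq> cl (scale s t) t}. q (s, t)) \<le> 8 * \<epsilon>"
proof -
  define sc where "sc y = scale (fst y) (snd y)" for y
  \<comment> \<open>\<open>Q k v\<close> gathers the weight of the pairs of scale \<open>k\<close>
    that start at \<open>v\<close>: the separation of a pair is charged to its first vertex, at its
    own scale only.\<close>
  define Q where "Q k v = (\<Sum>y | y \<in> pairs \<and> (sc y, fst y) = (k, v). q y)" for k v
  have group: "(\<Sum>k<J. \<Sum>v\<in>V. \<Sum>y | y \<in> pairs \<and> (sc y, fst y) = (Suc k, v). \<phi> y) = sum \<phi> pairs"
    for \<phi> :: "'v \<times> 'v \<Rightarrow> real"
  proof -
    have "(\<Sum>k<J. \<Sum>v\<in>V. \<Sum>y | y \<in> pairs \<and> (sc y, fst y) = (Suc k, v). \<phi> y) =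
        (\<Sum>k\<in>{Suc 0..J}. \<Sum>v\<in>V. \<Sum>y | y \<in> pairs \<and> (sc y, fst y) = (k, v). \<phi> y)"
      by (rule sum.atLeast1_atMost_eq[symmetric])
    also have "\<dots> = (\<Sum>z\<in>{Suc 0..J} \<times> V. \<Sum>y | y \<in> pairs \<and> (sc y, fst y) = z. \<phi> y)"
      by (simp only: sum.cartesian_product case_prod_unfold prod.collapse)
    also have "\<dots> = sum \<phi> pairs"
    proof (rule sum.group)
      show "(\<lambda>y. (sc y, fst y)) ` pairs \<subseteq> {Suc 0..J} \<times> V"
      proof
        fix z assume "z \<in> (\<lambda>y. (sc y, fst y)) ` pairs"
        then obtain s t where "(s, t) \<in> pairs" "z = (scale s t, s)"
          unfolding sc_def by (metis (no_types, lifting) imageE prod.collapse)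
        then show "z \<in> {Suc 0..J} \<times> V"
          using scale_props(2,3)[of s t] pairs_sub by (auto simp: Suc_le_eq)
      qed
    qed (auto simp: finite_pairs finite_vertices)
    finally show ?thesis .
  qed
  \<comment> \<open>The volume recurs at each of the \<open>J\<close> levels, while a pair counts at
    a single level. Division by \<open>J\<close> makes the two totals comparable, so that one
    partition per level serves both purposes.\<close>
  define \<mu> where "\<mu> k f v = vol v * (card (f ` N k v) + 1) / J + Q (Suc k) v"
    for k v and f :: "'v \<Rightarrow> 'v"
  have Q_nonneg: "0 \<le> Q k v" for k v
    unfolding Q_def using q by (intro sum_nonneg) auto
  define good where "good k f g \<longleftrightarrow> (\<forall>v\<in>V. (g v, v) \<in> reach (Suc k)) \<and>
      (\<Sum>v\<in>V. \<mu> k f v * card (g ` N (Suc k) v)) \<le> (1 + \<epsilon>) * sum (\<mu> k f) V" for k f g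
  have "\<exists>g. good k f g" for k f
  proof -
    have "0 \<le> \<mu> k f v" if "v \<in> V" for v
      using vol(1)[OF that] Q_nonneg by (simp add: \<mu>_def)
    from sparse_partition[of V "N (Suc k)" "\<mu> k f" \<epsilon> M, OF finite_vertices N_sub N_refl N_sym this \<epsilon>(1) M]
    obtain g where "\<And>v. v \<in> V \<Longrightarrow> (g v, v) \<in> {(x, y). x \<in> V \<and> y \<in> N (Suc k) x} ^^ (2 * M + 3)"
      "(\<Sum>v\<in>V. \<mu> k f v * card (g ` N (Suc k) v)) \<le> (1 + \<epsilon>) * sum (\<mu> k f) V"
      by blast
    then show ?thesis unfolding reach_def good_def by blast
  qed
  \<comment> \<open>The weight for level \<open>Suc k\<close> depends on the partition of level
    \<open>k\<close>, so the partitions are chosen one after the other, starting with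
    singletons.\<close>
  then obtain cl where cl0: "cl 0 = id" and good: "\<And>k. good k (cl k) (cl (Suc k))"
    using dependent_nat_choice[of "\<lambda>k f. k = 0 \<longrightarrow> f = id" good] by auto
  have reach_Suc: "(cl (Suc k) v, v) \<in> reach (Suc k)" if "v \<in> V" for k v
    using good[of k] that by (simp add: good_def)
  have cl_sum: "(\<Sum>v\<in>V. \<mu> k (cl k) v * spread cl (Suc k) v) \<le> (1 + \<epsilon>) * sum (\<mu> k (cl k)) V" for k
    using good[of k] by (simp add: good_def spread_def)
  have reach: "(cl k v, v) \<in> reach k" if "v \<in> V" for k v
  proof (cases k)
    case 0
    have "(v, v) \<in> {(x, y). x \<in> V \<and> y \<in> N 0 x} ^^ l" for l
      by (induction l) (use that N_refl in auto)
    then show ?thesis by (simp add: 0 cl0 reach_def)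
  qed (use that reach_Suc in simp)
  let ?X = "spread cl"
  define W where "W = sum vol V"
  define a where "a k = (\<Sum>v\<in>V. vol v * ?X k v)" for k
  define b where "b k = (\<Sum>v\<in>V. vol v * ?X k v * ?X (Suc k) v)" for k
  define F where "F k = (\<Sum>v\<in>V. Q k v * (?X k v - 1))" for k
  have W: "0 \<le> W" "W \<le> 2" using vol by (auto simp: W_def intro: sum_nonneg)
  \<comment> \<open>The total weight is subtracted from both sides of \<open>cl_sum\<close>. As a
    spread is at least \<open>1\<close>, three nonnegative excesses \<open>b k - a k\<close>,
    \<open>a (Suc k) - W\<close> and \<open>F (Suc k)\<close> remain on the left, and on the right
    only the share \<open>\<epsilon>\<close> is left.\<close>
  have step: "(b k - a k + a (Suc k) - W) / J + F (Suc k) \<le>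
      \<epsilon> * ((a k + W) / J + (\<Sum>v\<in>V. Q (Suc k) v))" for k
  proof -
    have m: "\<mu> k (cl k) v = vol v * (?X k v + 1) / J + Q (Suc k) v" for v
      by (simp add: \<mu>_def spread_def)
    have s: "sum (\<mu> k (cl k)) V = (a k + W) / J + (\<Sum>v\<in>V. Q (Suc k) v)"
      unfolding m a_def W_def by (simp add: sum.distrib sum_divide_distrib algebra_simps add_divide_distrib)
    have "(\<Sum>v\<in>V. \<mu> k (cl k) v * ?X (Suc k) v) =
        (b k + a (Suc k)) / J + (F (Suc k) + (\<Sum>v\<in>V. Q (Suc k) v))"
      unfolding m a_def b_def F_def
      by (simp add: sum.distrib sum_divide_distrib algebra_simps add_divide_distrib sum_subtractf)
    with cl_sum[of k] s show ?thesis
      by (simp add: algebra_simps add_divide_distrib diff_divide_distrib)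
  qed
  have F_nonneg: "0 \<le> F k" for k
    unfolding F_def using Q_nonneg spread_ge_one by (intro sum_nonneg mult_nonneg_nonneg) auto
  have a_le_b: "a k \<le> b k" for k
  proof -
    have "vol v * ?X k v * 1 \<le> vol v * ?X k v * ?X (Suc k) v" if "v \<in> V" for v
      using vol(1) spread_ge_one that by (intro mult_left_mono) (auto simp: spread_def)
    then show ?thesis unfolding a_def b_def by (auto intro: sum_mono)
  qed
  have a_ge: "W \<le> a k" for k
  proof -
    have "vol v * 1 \<le> vol v * ?X k v" if "v \<in> V" for v
      using vol(1) spread_ge_one that by (intro mult_left_mono) auto
    then show ?thesis unfolding a_def W_def by (auto intro: sum_mono)
  qed
  have a0: "a 0 = W"
  proof -
    have "?X 0 v = 1" if "v \<in> V" for v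
    proof -
      have "N 0 v = {v}" using N_zero N_refl[OF that] by fastforce
      then show ?thesis by (simp add: spread_def)
    qed
    then show ?thesis by (simp add: a_def W_def)
  qed
  have Q_sum: "(\<Sum>k<J. \<Sum>v\<in>V. Q (Suc k) v) \<le> 1"
    unfolding Q_def group by (rule q(2))
  define A where "A = (\<Sum>k<J. a k)"
  define B where "B = (\<Sum>k<J. b k)"
  define F' where "F' = (\<Sum>k<J. F (Suc k))"
  have A_shift: "(\<Sum>k<J. a (Suc k)) = A - W + a J"
    using sum.lessThan_Suc_shift[of a J] by (simp add: A_def a0)
  have "(\<Sum>k<J. (b k - a k + a (Suc k) - W) / J + F (Suc k)) \<le>
      (\<Sum>k<J. \<epsilon> * ((a k + W) / J + (\<Sum>v\<in>V. Q (Suc k) v)))"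
    by (rule sum_mono) (rule step)
  also have "(\<Sum>k<J. (b k - a k + a (Suc k) - W) / J + F (Suc k)) = 
      (B - A + (A - W + a J) - J * W) / J + F'"
    by (simp add: sum.distrib sum_divide_distrib[symmetric] sum_subtractf A_shift F'_def
        flip: A_def B_def)
  also have "(\<Sum>k<J. \<epsilon> * ((a k + W) / J + (\<Sum>v\<in>V. Q (Suc k) v))) =
      \<epsilon> * ((A + J * W) / J + (\<Sum>k<J. \<Sum>v\<in>V. Q (Suc k) v))"
    by (simp add: sum.distrib sum_divide_distrib[symmetric] flip: A_def sum_distrib_left)
  also have "\<dots> \<le> \<epsilon> * ((A + J * W) / J + 1)"
    using Q_sum \<epsilon> by (intro mult_left_mono) auto
  finally have main: "(B - A + (A - W + a J) - J * W) / J + F' \<le> \<epsilon> * ((A + J * W) / J + 1)" .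
  have AB: "A \<le> B" unfolding A_def B_def by (rule sum_mono) (rule a_le_b)
  have AW: "J * W \<le> A" using sum_mono[of "{..<J}" "\<lambda>_. W" a] a_ge by (simp add: A_def)
  have aJ: "W \<le> a J" by (rule a_ge)
  have F': "0 \<le> F'" unfolding F'_def by (intro sum_nonneg F_nonneg)
  have Jpos: "1 \<le> real J" using J by simp
  have main': "(B - A) + (A - W + a J - J * W) + F' * J \<le> \<epsilon> * (A + J * W + J)"
  proof -
    have cancel: "(y / J + z) * J = y + z * J" for y z :: real
      using Jpos by (simp add: distrib_right)
    have "((B - A + (A - W + a J) - J * W) / J + F') * J \<le> (\<epsilon> * ((A + J * W) / J + 1)) * J"
      using main by (intro mult_right_mono) auto
    then show ?thesis
      unfolding mult.assoc[of \<epsilon>] cancel by (simp add: add.assoc)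
  qed
  have JW: "J * W \<le> real J * 2" using W by (intro mult_left_mono) auto
  have FJ: "0 \<le> F' * J" using F' by simp
  have A0: "0 \<le> A + J * W + J" using AW W Jpos mult_nonneg_nonneg[of "real J" W] by linarith
  have eps10: "\<epsilon> * (A + J * W + J) \<le> 1 / 10 * (A + J * W + J)"
    using \<epsilon> A0 by (intro mult_right_mono) auto
  \<comment> \<open>Since \<open>\<epsilon>\<close> is at most \<open>1 / 10\<close>, the occurrence
    of \<open>A\<close> on the right is absorbed by the left. The inequality is linear once products
    such as \<open>J * W\<close> are replaced by variables.\<close>
  have A5: "A \<le> 3 * real J" and "B \<le> 8 * real J"
  proof -
    have "A \<le> 3 * j \<and> B \<le> 8 * j"
      if "B - A + (A - W + aJ - z) + f \<le> y" "y \<le> 1 / 10 * (A + z + j)" "0 \<le> f" "z \<le> j * 2"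
        "W \<le> aJ" "1 \<le> j" "z \<le> A" "A \<le> B" for A B aJ z f y j :: real
      using that by (auto simp: field_simps)
    from this[OF main' eps10 FJ JW aJ Jpos AW AB]
    show "A \<le> 3 * real J" "B \<le> 8 * real J" by auto
  qed
  then have one: "(\<Sum>k<J. \<Sum>v\<in>V. vol v * ?X k v * ?X (Suc k) v) \<le> 8 * real J"
    by (simp add: B_def b_def)
  \<comment> \<open>The second use of \<open>main'\<close> keeps \<open>\<epsilon>\<close> itself:
    with \<open>A\<close> now bounded by a multiple of \<open>J\<close>, the excess
    \<open>F'\<close> is at most a multiple of \<open>\<epsilon>\<close>.\<close>
  have "\<epsilon> * (A + J * W + J) \<le> \<epsilon> * (8 * real J)"
    using A5 JW \<epsilon> by (intro mult_left_mono) auto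
  then have "F' * J \<le> (8 * \<epsilon>) * J"
    using main' AB AW aJ by (simp add: algebra_simps)
  then have F'8: "F' \<le> 8 * \<epsilon>" using Jpos by simp
  have "(\<Sum>(s, t)\<in>{(s, t)\<in>pairs. cl (scale s t) s \<noteq> cl (scale s t) t}. q (s, t)) \<le>
      (\<Sum>(s, t)\<in>pairs. q (s, t) * (?X (scale s t) s - 1))"
  proof -
    have "(\<Sum>(s, t)\<in>{(s, t)\<in>pairs. cl (scale s t) s \<noteq> cl (scale s t) t}. q (s, t)) \<le>
      (\<Sum>(s, t)\<in>{(s, t)\<in>pairs. cl (scale s t) s \<noteq> cl (scale s t) t}. q (s, t) * (?X (scale s t) s - 1))"
    proof (intro sum_mono)
      fix x assume "x \<in> {(s, t)\<in>pairs. cl (scale s t) s \<noteq> cl (scale s t) t}"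
      then obtain s t where x: "x = (s, t)" "(s, t) \<in> pairs" "cl (scale s t) s \<noteq> cl (scale s t) t"
        by auto
      have "q (s, t) * 1 \<le> q (s, t) * (?X (scale s t) s - 1)"
        using q(1)[OF x(2)] separated_imp_spread[where cl = cl, OF scale_props(1)[OF x(2)] x(3)]
        by (intro mult_left_mono) auto
      then show "(case x of (s, t) \<Rightarrow> q (s, t)) \<le>
          (case x of (s, t) \<Rightarrow> q (s, t) * (?X (scale s t) s - 1))"
        by (simp add: x)
    qed
    also have "\<dots> \<le> (\<Sum>(s, t)\<in>pairs. q (s, t) * (?X (scale s t) s - 1))"
      using finite_pairs q(1) spread_ge_one pairs_sub
      by (intro sum_mono2) (auto intro!: mult_nonneg_nonneg)
    finally show ?thesis .
  qed
  also have "\<dots> = (\<Sum>k<J. \<Sum>v\<in>V. \<Sum>y | y \<in> pairs \<and> (sc y, fst y) = (Suc k, v). q y * (?X (sc y) (fst y) - 1))"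
    unfolding group by (simp add: sc_def case_prod_unfold)
  also have "\<dots> = F'"
    unfolding F'_def F_def Q_def sum_distrib_right by (intro sum.cong refl) auto
  finally show ?thesis
    using F'8 by (intro that[of cl]) (use one reach cl0 in auto)
qed

end

section \<open>Routing through cluster centres\<close>

text \<open>A witness scheme and a real bound replace the infimum in \<open>hop_opt\<close>, so the
  argument never has to ask whether the infimum is attained.\<close>

definition hop_routable ::
    "'v set \<Rightarrow> 'v set set \<Rightarrow> ('v set \<Rightarrow> real) \<Rightarrow> nat \<Rightarrow> ('v \<Rightarrow> 'v \<Rightarrow> real) \<Rightarrow> real \<Rightarrow> bool"
  where
  "hop_routable V E c h D \<kappa> \<longleftrightarrow> is_demand V D \<and> 0 \<le> \<kappa> \<and>
     (\<exists>R. routing_scheme V E (demand_support V D) R \<and> hop_bounded (demand_support V D) (real h) R \<and>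
       (\<forall>e\<in>E. demand_flow V D R e \<le> ennreal (\<kappa> * c e)))"

text \<open>Here \<open>f s t\<close> is the path chosen for the pair.  The value \<open>[]\<close>, which is not a path and carries no
  flow, marks a pair that is not served.\<close>

definition load_bound ::
    "'v set \<Rightarrow> 'v set set \<Rightarrow> ('v set \<Rightarrow> real) \<Rightarrow> nat \<Rightarrow> ('v \<Rightarrow> 'v \<Rightarrow> 'v list) \<Rightarrow> ('v set \<Rightarrow> real) \<Rightarrow> bool"
  where "load_bound V E c h f x \<longleftrightarrow> (\<forall>D \<kappa>. hop_routable V E c h D \<kappa> \<longrightarrow>
     (\<forall>e\<in>E. (\<Sum>s\<in>V. \<Sum>t\<in>V. D s t * real (count_list (path_edges (f s t)) e)) \<le> \<kappa> * x e))"

primrec climb :: "(nat \<Rightarrow> 'v \<Rightarrow> 'v \<Rightarrow> 'v list) \<Rightarrow> (nat \<Rightarrow> 'v \<Rightarrow> 'v) \<Rightarrow> 'v \<Rightarrow> nat \<Rightarrow> 'v list" where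
  "climb \<pi> cl u 0 = [u]"
| "climb \<pi> cl u (Suc k) = climb \<pi> cl u k @ tl (\<pi> k (cl k u) (cl (Suc k) u))"

lemma climb_path:
  assumes "u \<in> V" "cl 0 u = u"
    and "\<And>k. path_between V E (cl k u) (cl (Suc k) u) (\<pi> k (cl k u) (cl (Suc k) u))"
    and "\<And>k. hop (\<pi> k (cl k u) (cl (Suc k) u)) \<le> m"
  shows "path_between V E u (cl j u) (climb \<pi> cl u j)" "hop (climb \<pi> cl u j) \<le> j * m"
    "count_list (path_edges (climb \<pi> cl u j)) e =
      (\<Sum>k<j. count_list (path_edges (\<pi> k (cl k u) (cl (Suc k) u))) e)"
proof -
  have "path_between V E u (cl j u) (climb \<pi> cl u j) \<and> hop (climb \<pi> cl u j) \<le> j * m \<and>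
    count_list (path_edges (climb \<pi> cl u j)) e =
      (\<Sum>k<j. count_list (path_edges (\<pi> k (cl k u) (cl (Suc k) u))) e)"
  proof (induction j)
    case 0
    then show ?case using assms(1,2) by (simp add: hop_def)
  next
    case (Suc j)
    then have IH: "path_between V E u (cl j u) (climb \<pi> cl u j)" by simp
    show ?case
      using Suc path_between_join[OF IH assms(3)] hop_join[OF IH assms(3)] assms(4)[of j]
        path_edges_join[of "climb \<pi> cl u j" "\<pi> j (cl j u) (cl (Suc j) u)"]
        path_between_ends[OF IH] path_between_ends[OF assms(3)[of j]]
      by (simp add: add.commute add_mono)
  qed
  then show "path_between V E u (cl j u) (climb \<pi> cl u j)" "hop (climb \<pi> cl u j) \<le> j * m"
    "count_list (path_edges (climb \<pi> cl u j)) e =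
      (\<Sum>k<j. count_list (path_edges (\<pi> k (cl k u) (cl (Suc k) u))) e)"
    by blast+
qed

section \<open>Charging demand to volume, and the routing for fixed weights\<close>

context weighted_levels begin

text \<open>Every walk by which the witness routing serves a pair of \<open>Y\<close> spends weight
  \<open>\<delta>\<close> or more on edges meeting \<open>B\<close>. In expectation, the demand of
  \<open>Y\<close> times \<open>\<delta>\<close> is at most the weighted flow on these edges, and
  the flow on \<open>e\<close> is at most \<open>\<kappa> * c e\<close>.\<close>

lemma demand_near_set:
  assumes D: "hop_routable V E c h D \<kappa>" and \<delta>: "0 \<le> \<delta>"
    and Y: "Y \<subseteq> V \<times> V" "\<And>s t. (s, t) \<in> Y \<Longrightarrow> \<not> near V E w h \<delta> s t \<and> (s \<in> A \<or> t \<in> A)"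
    and B: "\<And>u x. u \<in> A \<Longrightarrow> near V E w h \<delta> u x \<Longrightarrow> x \<in> B"
  shows "(\<Sum>(s, t)\<in>Y. D s t) * \<delta> \<le> \<kappa> * (\<Sum>e | e \<in> E \<and> e \<inter> B \<noteq> {}. w e * c e)"
proof -
  obtain R where R: "routing_scheme V E (demand_support V D) R"
      "hop_bounded (demand_support V D) (real h) R"
      "\<And>e. e \<in> E \<Longrightarrow> demand_flow V D R e \<le> ennreal (\<kappa> * c e)"
    and D_nonneg: "\<And>s t. s \<in> V \<Longrightarrow> t \<in> V \<Longrightarrow> 0 \<le> D s t" and \<kappa>: "0 \<le> \<kappa>"
    using D by (auto simp: hop_routable_def is_demand_def)
  define E' where "E' = {e \<in> E. e \<inter> B \<noteq> {}}"
  have fin: "finite E'" "finite Y"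
    using finite_edges finite_vertices Y(1) finite_subset[of Y "V \<times> V"] by (auto simp: E'_def)
  define F where "F s t e = (\<integral>\<^sup>+p. path_flow p e \<partial>measure_pmf (R s t))" for s t e
  have one: "ennreal (D s t) * ennreal \<delta> \<le> (\<Sum>e\<in>E'. ennreal (w e) * (ennreal (D s t) * F s t e))"
    if st: "(s, t) \<in> Y" for s t
  proof (cases "D s t > 0")
    case True
    then have supp: "(s, t) \<in> demand_support V D"
      using st Y(1) by (auto simp: demand_support_def)
    have "ennreal \<delta> \<le> (\<Sum>e\<in>E'. ennreal (w e) * path_flow p e)" if p: "p \<in> set_pmf (R s t)" for p
    proof -
      have p: "path_between V E s t p" "hop p \<le> h"
        using R(1,2) supp p by (auto simp: routing_scheme_def hop_bounded_def)
      obtain x where x: "x \<in> A" "x = s \<or> x = t" using Y(2)[OF st] by blast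
      have "\<delta> \<le> (\<Sum>e\<in>E'. real (count_list (path_edges p) e) * w e)"
        unfolding E'_def using Y(2)[OF st] B[OF x(1)] w_pos
        by (intro weight_inside_neighbourhood_ends[OF p _ _ x(2) _ finite_edges])
          (auto simp: less_imp_le)
      then have "ennreal \<delta> \<le> ennreal (\<Sum>e\<in>E'. real (count_list (path_edges p) e) * w e)"
        by (rule ennreal_leI)
      also have "\<dots> = (\<Sum>e\<in>E'. ennreal (w e) * path_flow p e)"
        using w_pos by (subst sum_ennreal[symmetric])
          (auto simp: E'_def less_imp_le path_flow_def ennreal_mult ennreal_of_nat_eq_real_of_nat
            mult.commute intro!: sum.cong)
      finally show ?thesis .
    qed
    then have "(\<integral>\<^sup>+p. ennreal \<delta> \<partial>measure_pmf (R s t)) \<le>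
        (\<integral>\<^sup>+p. (\<Sum>e\<in>E'. ennreal (w e) * path_flow p e) \<partial>measure_pmf (R s t))"
      by (intro nn_integral_mono_AE) (simp add: AE_measure_pmf_iff)
    also have "\<dots> = (\<Sum>e\<in>E'. ennreal (w e) * F s t e)"
      by (simp add: nn_integral_sum nn_integral_cmult F_def)
    finally have "ennreal (D s t) * ennreal \<delta> \<le> ennreal (D s t) * (\<Sum>e\<in>E'. ennreal (w e) * F s t e)"
      by (intro mult_left_mono) simp_all
    then show ?thesis
      by (simp add: sum_distrib_left mult.left_commute)
  qed (simp add: ennreal_neg)
  have "ennreal ((\<Sum>(s, t)\<in>Y. D s t) * \<delta>) = (\<Sum>(s, t)\<in>Y. ennreal (D s t) * ennreal \<delta>)"
  proof -
    have "ennreal (\<Sum>x\<in>Y. D (fst x) (snd x)) = (\<Sum>x\<in>Y. ennreal (D (fst x) (snd x)))"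
      using Y(1) D_nonneg by (intro sum_ennreal[symmetric]) auto
    moreover have "0 \<le> (\<Sum>x\<in>Y. D (fst x) (snd x))"
      using Y(1) D_nonneg by (intro sum_nonneg) auto
    ultimately show ?thesis
      using \<delta> unfolding case_prod_unfold sum_distrib_right[symmetric] by (simp add: ennreal_mult)
  qed
  also have "\<dots> \<le> (\<Sum>(s, t)\<in>Y. \<Sum>e\<in>E'. ennreal (w e) * (ennreal (D s t) * F s t e))"
    using one by (intro sum_mono) auto
  also have "\<dots> \<le> (\<Sum>(s, t)\<in>V \<times> V. \<Sum>e\<in>E'. ennreal (w e) * (ennreal (D s t) * F s t e))"
    using Y(1) finite_vertices by (intro sum_mono2) auto
  also have "\<dots> = (\<Sum>e\<in>E'. \<Sum>(s, t)\<in>V \<times> V. ennreal (w e) * (ennreal (D s t) * F s t e))"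
    unfolding case_prod_unfold by (rule sum.swap)
  also have "\<dots> = (\<Sum>e\<in>E'. ennreal (w e) * demand_flow V D R e)"
    by (simp add: demand_flow_def F_def sum.cartesian_product case_prod_unfold sum_distrib_left)
  also have "\<dots> \<le> (\<Sum>e\<in>E'. ennreal (w e) * ennreal (\<kappa> * c e))"
    using R(3) by (intro sum_mono mult_left_mono) (auto simp: E'_def)
  also have "\<dots> = (\<Sum>e\<in>E'. ennreal (\<kappa> * (w e * c e)))"
    using w_pos \<kappa> capacity_pos
    by (intro sum.cong) (auto simp: E'_def ennreal_mult[symmetric] less_imp_le mult.left_commute)
  also have "\<dots> = ennreal (\<kappa> * (\<Sum>e\<in>E'. w e * c e))"
    using w_pos \<kappa> capacity_pos
    by (subst sum_ennreal) (auto simp: E'_def less_imp_le sum_distrib_left)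
  finally have "ennreal ((\<Sum>(s, t)\<in>Y. D s t) * \<delta>) \<le> ennreal (\<kappa> * (\<Sum>e\<in>E'. w e * c e))" .
  moreover have "0 \<le> \<kappa> * (\<Sum>e\<in>E'. w e * c e)"
  proof (intro mult_nonneg_nonneg sum_nonneg \<kappa>)
    fix e assume "e \<in> E'"
    then show "0 \<le> w e" "0 \<le> c e"
      using w_pos[of e] capacity_pos[of e] by (auto simp: E'_def)
  qed
  ultimately show ?thesis
    by (simp add: E'_def)
qed

lemma reach_path:
  assumes "(a, u) \<in> reach k" "u \<in> V"
  obtains p where "path_between V E a u p" "hop p \<le> (2 * M + 3) * h"
    "path_weight w p \<le> (2 * M + 3) * (2 ^ k * \<rho>)"
  using assms relpow_near_path[where u = a and v = u and V = V and E = E and w = w and h = h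
      and \<rho> = "2 ^ k * \<rho>" and k = "2 * M + 3"]
  unfolding reach_def N_def mem_Collect_eq by blast

text \<open>The walk goes through \<open>u\<close>, but its bounds depend on the level alone. Its
  second half belongs to level \<open>Suc k\<close>, whose steps may weigh twice as much, hence the
  factor \<open>3\<close>.\<close>

lemma centre_path:
  assumes "\<And>k v. v \<in> V \<Longrightarrow> (cl k v, v) \<in> reach k" "u \<in> V"
  obtains p where "path_between V E (cl k u) (cl (Suc k) u) p" "hop p \<le> 2 * (2 * M + 3) * h"
    "path_weight w p \<le> 3 * (2 * M + 3) * (2 ^ k * \<rho>)"
proof -
  obtain p where p: "path_between V E (cl k u) u p" "hop p \<le> (2 * M + 3) * h"
    "path_weight w p \<le> (2 * M + 3) * (2 ^ k * \<rho>)"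
    using reach_path assms by blast
  obtain q where q: "path_between V E (cl (Suc k) u) u q" "hop q \<le> (2 * M + 3) * h"
    "path_weight w q \<le> (2 * M + 3) * (2 ^ Suc k * \<rho>)"
    using reach_path assms by blast
  note j = p(1) path_between_rev[OF q(1)]
  have "hop (p @ tl (rev q)) \<le> 2 * (2 * M + 3) * h"
    using hop_join[OF j] p(2) q(2) by (simp add: hop_rev algebra_simps)
  moreover have "path_weight w (p @ tl (rev q)) \<le> 3 * (2 * M + 3) * (2 ^ k * \<rho>)"
    using path_weight_join[OF j, of w] p(3) q(3) by (simp add: path_weight_rev algebra_simps)
  ultimately show ?thesis
    using path_between_join[OF j] that by blast
qed

text \<open>The answer to fixed weights \<open>w\<close> on the edges and \<open>q\<close> on the
  pairs is one deterministic system of paths \<open>f\<close>. \<open>x\<close> bounds its load per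
  unit of congestion for all demands at once; the pairs separated at their scale are left
  unserved.\<close>

lemma routing_of_weights:
  fixes q :: "'v \<times> 'v \<Rightarrow> real"
  assumes w1: "(\<Sum>e\<in>E. w e * c e) \<le> 1"
    and q: "\<And>y. y \<in> pairs \<Longrightarrow> 0 \<le> q y" "sum q pairs \<le> 1"
  obtains f x where "load_bound V E c h f x"
    "\<And>s t. f s t \<noteq> [] \<Longrightarrow> path_between V E s t (f s t) \<and> hop (f s t) \<le> 4 * J * (2 * M + 3) * h"
    "\<And>e. e \<in> E \<Longrightarrow> 0 \<le> x e" "(\<Sum>e\<in>E. w e * x e) \<le> 48 * (2 * M + 3) * J"
    "(\<Sum>y\<in>{(s, t)\<in>pairs. f s t = []}. q y) \<le> 8 * \<epsilon>"
proof -
  define vol where "vol v = (\<Sum>e | e \<in> E \<and> v \<in> e. w e * c e)" for v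
  have wc: "0 \<le> w e * c e" if "e \<in> E" for e
    using w_pos[OF that] capacity_pos[OF that] by simp
  have vol_nonneg: "0 \<le> vol v" for v
    unfolding vol_def by (intro sum_nonneg) (use wc in auto)
  have vol2: "sum vol V \<le> 2"
    unfolding vol_def using vertex_sum_eq[of "\<lambda>e. w e * c e"] w1 by simp
  obtain cl where cl0: "\<And>v. cl 0 v = v"
    and reach: "\<And>k v. v \<in> V \<Longrightarrow> (cl k v, v) \<in> reach k"
    and spread_sum: "(\<Sum>k<J. \<Sum>v\<in>V. vol v * spread cl k v * spread cl (Suc k) v) \<le> 8 * real J"
    and fail: "(\<Sum>(s, t)\<in>{(s, t)\<in>pairs. cl (scale s t) s \<noteq> cl (scale s t) t}. q (s, t)) \<le> 8 * \<epsilon>"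
    by (rule partitions[of vol q, OF vol_nonneg vol2 q]) blast+
  define good where "good k a b p \<longleftrightarrow> path_between V E a b p \<and> hop p \<le> 2 * (2 * M + 3) * h \<and>
    path_weight w p \<le> 3 * (2 * M + 3) * (2 ^ k * \<rho>)" for k a b p
  \<comment> \<open>The path is chosen by the centres alone, so that all vertices of a class share
    it. The choice is meaningful only for centres \<open>a\<close> and \<open>b\<close> that belong
    to a common vertex.\<close>
  define \<pi> where "\<pi> k a b = (SOME p. good k a b p)" for k a b
  have good: "good k (cl k u) (cl (Suc k) u) (\<pi> k (cl k u) (cl (Suc k) u))" if u: "u \<in> V" for u k
    unfolding \<pi>_def
  proof (rule someI_ex)
    obtain p where "path_between V E (cl k u) (cl (Suc k) u) p" "hop p \<le> 2 * (2 * M + 3) * h"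
      "path_weight w p \<le> 3 * (2 * M + 3) * (2 ^ k * \<rho>)"
      by (rule centre_path[of cl u k, OF reach u])
    then show "\<exists>p. good k (cl k u) (cl (Suc k) u) p"
      unfolding good_def by blast
  qed
  have cl_V: "cl k v \<in> V" if "v \<in> V" for k v
    using good[OF that, of k] path_between_ends(4)[of V E "cl k v"] unfolding good_def by blast
  define U where "U k a b = {u \<in> V. cl k u = a \<and> cl (Suc k) u = b}" for k a b
  define B where "B k a b = (\<Union>u\<in>U k a b. N k u)" for k a b
  have B_V: "B k a b \<subseteq> V" for k a b using N_sub by (auto simp: B_def)
  define bvol where "bvol k a b = (\<Sum>e | e \<in> E \<and> e \<inter> B k a b \<noteq> {}. w e * c e)" for k a b
  have bvol_nonneg: "0 \<le> bvol k a b" for k a b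
    unfolding bvol_def by (intro sum_nonneg) (use wc in auto)
  define n where "n k a b e = real (count_list (path_edges (\<pi> k a b)) e)" for k a b e
  \<comment> \<open>By \<open>demand_near_set\<close>, the quotient without its factor
    \<open>2\<close> bounds the demand that reaches the shared path from one end, per unit of
    congestion. The factor \<open>2\<close> accounts for the climbs from both ends of a
    pair.\<close>
  define x where "x e = (\<Sum>k<J. \<Sum>(a, b)\<in>V \<times> V. n k a b e * (2 * bvol k a b / (2 ^ k * \<rho>)))" for e
  define f where "f s t = (if (s, t) \<in> pairs \<and> cl (scale s t) s = cl (scale s t) t
    then climb \<pi> cl s (scale s t) @ tl (rev (climb \<pi> cl t (scale s t))) else [])" for s t
  have climb: "path_between V E u (cl j u) (climb \<pi> cl u j)"
    "hop (climb \<pi> cl u j) \<le> j * (2 * (2 * M + 3) * h)"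
    "real (count_list (path_edges (climb \<pi> cl u j)) e) = (\<Sum>k<j. n k (cl k u) (cl (Suc k) u) e)"
    if "u \<in> V" for u j e
  proof -
    have g: "path_between V E (cl k u) (cl (Suc k) u) (\<pi> k (cl k u) (cl (Suc k) u))"
      "hop (\<pi> k (cl k u) (cl (Suc k) u)) \<le> 2 * (2 * M + 3) * h" for k
      using good[OF that, of k] unfolding good_def by blast+
    note c = climb_path[where cl = cl and \<pi> = \<pi> and u = u and V = V and E = E, OF that cl0 g]
    show "path_between V E u (cl j u) (climb \<pi> cl u j)"
      "hop (climb \<pi> cl u j) \<le> j * (2 * (2 * M + 3) * h)"
      by (rule c)+
    show "real (count_list (path_edges (climb \<pi> cl u j)) e) = (\<Sum>k<j. n k (cl k u) (cl (Suc k) u) e)"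
      unfolding c(3) n_def by simp
  qed
  have f_path: "path_between V E s t (f s t) \<and> hop (f s t) \<le> 4 * J * (2 * M + 3) * h \<and>
      real (count_list (path_edges (f s t)) e) =
        (\<Sum>k<scale s t. n k (cl k s) (cl (Suc k) s) e + n k (cl k t) (cl (Suc k) t) e)"
    if "f s t \<noteq> []" for s t e
  proof -
    define j where "j = scale s t"
    have st: "(s, t) \<in> pairs" "cl j s = cl j t"
      and f: "f s t = climb \<pi> cl s j @ tl (rev (climb \<pi> cl t j))"
      using that by (auto simp: f_def j_def split: if_splits)
    have V: "s \<in> V" "t \<in> V" using st pairs_sub by auto
    have j: "j \<le> J" using scale_props(2)[OF st(1)] by (simp add: j_def)
    have p: "path_between V E s (cl j s) (climb \<pi> cl s j)"
      "path_between V E (cl j s) t (rev (climb \<pi> cl t j))"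
      unfolding st(2) using climb(1)[OF V(1), of j] path_between_rev[OF climb(1)[OF V(2), of j]] st(2)
      by simp_all
    have "hop (f s t) \<le> j * (2 * (2 * M + 3) * h) + j * (2 * (2 * M + 3) * h)"
      unfolding f hop_join[OF p] hop_rev using climb(2) V by (intro add_mono) auto
    also have "\<dots> = j * (4 * (2 * M + 3) * h)" by (simp add: algebra_simps)
    also have "\<dots> \<le> J * (4 * (2 * M + 3) * h)" using j by (intro mult_right_mono) auto
    also have "\<dots> = 4 * J * (2 * M + 3) * h" by simp
    finally have "hop (f s t) \<le> 4 * J * (2 * M + 3) * h" .
    moreover have "real (count_list (path_edges (f s t)) e) =
        (\<Sum>k<j. n k (cl k s) (cl (Suc k) s) e + n k (cl k t) (cl (Suc k) t) e)"
    proof -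
      have "path_edges (f s t) = path_edges (climb \<pi> cl s j) @ rev (path_edges (climb \<pi> cl t j))"
        unfolding f path_edges_rev[symmetric]
        using p by (intro path_edges_join) (auto simp: path_between_def)
      then show ?thesis
        using climb(3) V by (simp add: sum.distrib)
    qed
    ultimately show ?thesis
      using path_between_join[OF p] by (simp add: f j_def)
  qed
  \<comment> \<open>\<open>z\<close> selects the end whose climb is counted. Pairs are grouped by
    the two centres of that end, since the shared path depends on nothing else. A pair in
    \<open>Y\<close> has scale above \<open>k\<close>, so its ends are not near at level
    \<open>k\<close>, as \<open>demand_near_set\<close> requires.\<close>
  have half: "(\<Sum>y\<in>Y. D (fst y) (snd y) * n k (cl k (z y)) (cl (Suc k) (z y)) e) \<le>
      \<kappa> * (\<Sum>(a, b)\<in>V \<times> V. n k a b e * (bvol k a b / (2 ^ k * \<rho>)))"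
    if D: "hop_routable V E c h D \<kappa>" and z: "z = fst \<or> z = snd"
      and Y: "Y = {(s, t). (s, t) \<in> pairs \<and> k < scale s t}" for D \<kappa> k e z Y
  proof -
    define g where "g y = (cl k (z y), cl (Suc k) (z y))" for y
    have YV: "Y \<subseteq> V \<times> V" using pairs_sub Y by auto
    have zV: "z y \<in> V" if "y \<in> Y" for y using YV z that by auto
    have fin: "finite Y" using YV finite_vertices finite_subset by blast
    have "(\<Sum>y\<in>Y. D (fst y) (snd y) * n k (cl k (z y)) (cl (Suc k) (z y)) e) =
      (\<Sum>ab\<in>V \<times> V. \<Sum>y | y \<in> Y \<and> g y = ab. D (fst y) (snd y) * n k (cl k (z y)) (cl (Suc k) (z y)) e)"
      using fin finite_vertices zV cl_V by (intro sum.group[symmetric]) (auto simp: g_def)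
    also have "\<dots> \<le> (\<Sum>ab\<in>V \<times> V. \<kappa> * (n k (fst ab) (snd ab) e * (bvol k (fst ab) (snd ab) / (2 ^ k * \<rho>))))"
    proof (intro sum_mono)
      fix ab assume "ab \<in> V \<times> V"
      obtain a b where ab: "ab = (a, b)" by (cases ab)
      have "(\<Sum>(s, t)\<in>{y \<in> Y. g y = ab}. D s t) * (2 ^ k * \<rho>) \<le> \<kappa> * bvol k a b"
        unfolding bvol_def
      proof (rule demand_near_set[OF D])
        show "0 \<le> 2 ^ k * \<rho>" using \<rho>_pos by simp
        show "{y \<in> Y. g y = ab} \<subseteq> V \<times> V" using YV by auto
        show "\<not> near V E w h (2 ^ k * \<rho>) s t \<and> (s \<in> U k a b \<or> t \<in> U k a b)"
          if "(s, t) \<in> {y \<in> Y. g y = ab}" for s t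
          using that z zV[of "(s, t)"] scale_props(4)[of s t k]
          by (auto simp: U_def g_def ab Y N_def)
        show "v \<in> B k a b" if "u \<in> U k a b" "near V E w h (2 ^ k * \<rho>) u v" for u v
          using that by (auto simp: B_def N_def)
      qed
      then have "(\<Sum>(s, t)\<in>{y \<in> Y. g y = ab}. D s t) \<le> \<kappa> * bvol k a b / (2 ^ k * \<rho>)"
        using \<rho>_pos by (simp add: pos_le_divide_eq)
      then have "n k a b e * (\<Sum>(s, t)\<in>{y \<in> Y. g y = ab}. D s t) \<le>
          n k a b e * (\<kappa> * bvol k a b / (2 ^ k * \<rho>))"
        by (intro mult_left_mono) (simp_all add: n_def)
      moreover have "(\<Sum>y | y \<in> Y \<and> g y = ab. D (fst y) (snd y) * n k (cl k (z y)) (cl (Suc k) (z y)) e) =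
          n k a b e * (\<Sum>(s, t)\<in>{y \<in> Y. g y = ab}. D s t)"
        unfolding sum_distrib_left by (intro sum.cong) (auto simp: g_def ab)
      ultimately show "(\<Sum>y | y \<in> Y \<and> g y = ab. D (fst y) (snd y) * n k (cl k (z y)) (cl (Suc k) (z y)) e) \<le>
          \<kappa> * (n k (fst ab) (snd ab) e * (bvol k (fst ab) (snd ab) / (2 ^ k * \<rho>)))"
        by (simp add: ab mult_ac)
    qed
    finally show ?thesis by (simp add: sum_distrib_left case_prod_unfold)
  qed
  have load: "(\<Sum>s\<in>V. \<Sum>t\<in>V. D s t * real (count_list (path_edges (f s t)) e)) \<le> \<kappa> * x e"
    if D: "hop_routable V E c h D \<kappa>" for D \<kappa> e
  proof -
    have D_nonneg: "0 \<le> D s t" if "s \<in> V" "t \<in> V" for s t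
      using D that by (auto simp: hop_routable_def is_demand_def)
    define m where "m k u = n k (cl k u) (cl (Suc k) u) e" for k u
    define Y where "Y k = {(s, t). (s, t) \<in> pairs \<and> k < scale s t}" for k
    have m_nonneg: "0 \<le> m k u" for k u by (simp add: m_def n_def)
    have "(\<Sum>s\<in>V. \<Sum>t\<in>V. D s t * real (count_list (path_edges (f s t)) e)) =
        (\<Sum>y\<in>V \<times> V. D (fst y) (snd y) * real (count_list (path_edges (f (fst y) (snd y))) e))"
      by (simp add: sum.cartesian_product case_prod_unfold)
    also have "\<dots> = (\<Sum>y\<in>pairs. D (fst y) (snd y) * real (count_list (path_edges (f (fst y) (snd y))) e))"
      using pairs_sub finite_vertices by (intro sum.mono_neutral_right) (auto simp: f_def)
    also have "\<dots> \<le> (\<Sum>y\<in>pairs. \<Sum>k<J. if k < scale (fst y) (snd y)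
        then D (fst y) (snd y) * m k (fst y) + D (fst y) (snd y) * m k (snd y) else 0)"
    proof (intro sum_mono)
      fix y assume y: "y \<in> pairs"
      obtain s t where st: "y = (s, t)" by (cases y)
      have V: "s \<in> V" "t \<in> V" using y pairs_sub by (auto simp: st)
      have "real (count_list (path_edges (f s t)) e) \<le> (\<Sum>k<scale s t. m k s + m k t)"
        using f_path[of s t e] m_nonneg
        by (cases "f s t = []") (auto simp: m_def intro!: sum_nonneg add_nonneg_nonneg)
      also have "(\<Sum>k<scale s t. m k s + m k t) = (\<Sum>k<J. if k < scale s t then m k s + m k t else 0)"
        using scale_props(2)[of s t] y st by (intro sum.mono_neutral_cong_left) auto
      finally have "D s t * real (count_list (path_edges (f s t)) e) \<le>
          D s t * (\<Sum>k<J. if k < scale s t then m k s + m k t else 0)"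
        using D_nonneg V by (intro mult_left_mono) auto
      also have "\<dots> = (\<Sum>k<J. if k < scale s t then D s t * m k s + D s t * m k t else 0)"
        unfolding sum_distrib_left by (intro sum.cong) (auto simp: distrib_left)
      finally show "D (fst y) (snd y) * real (count_list (path_edges (f (fst y) (snd y))) e) \<le>
        (\<Sum>k<J. if k < scale (fst y) (snd y)
        then D (fst y) (snd y) * m k (fst y) + D (fst y) (snd y) * m k (snd y) else 0)"
        by (simp only: st fst_conv snd_conv)
    qed
    also have "\<dots> = (\<Sum>k<J. \<Sum>y\<in>pairs. if k < scale (fst y) (snd y)
        then D (fst y) (snd y) * m k (fst y) + D (fst y) (snd y) * m k (snd y) else 0)"
      by (rule sum.swap)
    also have "\<dots> = (\<Sum>k<J. (\<Sum>y\<in>Y k. D (fst y) (snd y) * m k (fst y)) +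
        (\<Sum>y\<in>Y k. D (fst y) (snd y) * m k (snd y)))"
    proof (intro sum.cong refl)
      fix k
      have Yk: "Y k = {y \<in> pairs. k < scale (fst y) (snd y)}" by (auto simp: Y_def)
      show "(\<Sum>y\<in>pairs. if k < scale (fst y) (snd y)
        then D (fst y) (snd y) * m k (fst y) + D (fst y) (snd y) * m k (snd y) else 0) =
        (\<Sum>y\<in>Y k. D (fst y) (snd y) * m k (fst y)) + (\<Sum>y\<in>Y k. D (fst y) (snd y) * m k (snd y))"
        unfolding sum.distrib[symmetric] Yk by (rule sum.inter_filter[OF finite_pairs, symmetric])
    qed
    also have "\<dots> \<le> (\<Sum>k<J. \<kappa> * (\<Sum>(a, b)\<in>V \<times> V. n k a b e * (bvol k a b / (2 ^ k * \<rho>))) +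
        \<kappa> * (\<Sum>(a, b)\<in>V \<times> V. n k a b e * (bvol k a b / (2 ^ k * \<rho>))))"
      unfolding m_def by (intro sum_mono add_mono half[OF D]) (auto simp: Y_def)
    also have "\<dots> = \<kappa> * x e"
      unfolding x_def sum_distrib_left
      by (intro sum.cong refl) (simp add: sum.distrib[symmetric] case_prod_unfold algebra_simps)
    finally show ?thesis .
  qed
  have x_sum: "(\<Sum>e\<in>E. w e * x e) \<le> 48 * (2 * M + 3) * J"
  proof -
    have "(\<Sum>e\<in>E. w e * x e) = (\<Sum>e\<in>E. \<Sum>k<J. \<Sum>(a, b)\<in>V \<times> V. n k a b e * w e * (2 * bvol k a b / (2 ^ k * \<rho>)))"
      unfolding x_def by (simp add: sum_distrib_left case_prod_unfold mult_ac)
    also have "\<dots> = (\<Sum>k<J. \<Sum>e\<in>E. \<Sum>(a, b)\<in>V \<times> V. n k a b e * w e * (2 * bvol k a b / (2 ^ k * \<rho>)))"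
      by (rule sum.swap)
    also have "\<dots> = (\<Sum>k<J. \<Sum>(a, b)\<in>V \<times> V. (\<Sum>e\<in>E. n k a b e * w e) * (2 * bvol k a b / (2 ^ k * \<rho>)))"
      unfolding sum_distrib_right case_prod_unfold by (intro sum.cong refl) (rule sum.swap)
    also have "\<dots> \<le> (\<Sum>k<J. 6 * (2 * M + 3) * (\<Sum>v\<in>V. vol v * spread cl k v * spread cl (Suc k) v))"
    proof (intro sum_mono)
      fix k
      have "(\<Sum>(a, b)\<in>V \<times> V. (\<Sum>e\<in>E. n k a b e * w e) * (2 * bvol k a b / (2 ^ k * \<rho>))) \<le>
          (\<Sum>(a, b)\<in>V \<times> V. 6 * (2 * M + 3) * (\<Sum>v\<in>B k a b. vol v))"
      proof (intro sum_mono)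
        fix ab assume "ab \<in> V \<times> V"
        obtain a b where ab: "ab = (a, b)" by (cases ab)
        have "(\<Sum>e\<in>E. n k a b e * w e) * (2 * bvol k a b / (2 ^ k * \<rho>)) \<le>
            6 * (2 * M + 3) * (\<Sum>v\<in>B k a b. vol v)"
        \<comment> \<open>If no vertex has these centres, nothing is known about
          \<open>\<pi> k a b\<close>, but the volume factor vanishes.\<close>
        proof (cases "U k a b = {}")
          case True
          then show ?thesis by (simp add: bvol_def B_def)
        next
          case False
          then obtain u where "u \<in> V" "cl k u = a" "cl (Suc k) u = b" by (auto simp: U_def)
          then have g: "good k a b (\<pi> k a b)" using good by blast
          have "(\<Sum>e\<in>E. n k a b e * w e) = path_weight w (\<pi> k a b)"
            using g path_between_edges path_weight_eq_sum[OF finite_edges]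
            unfolding good_def n_def by metis
          then have "(\<Sum>e\<in>E. n k a b e * w e) \<le> 3 * (2 * M + 3) * (2 ^ k * \<rho>)"
            using g by (simp add: good_def)
          then have "(\<Sum>e\<in>E. n k a b e * w e) * (2 * bvol k a b / (2 ^ k * \<rho>)) \<le>
              3 * (2 * M + 3) * (2 ^ k * \<rho>) * (2 * bvol k a b / (2 ^ k * \<rho>))"
            using bvol_nonneg \<rho>_pos by (intro mult_right_mono) auto
          also have "\<dots> = 6 * (2 * M + 3) * bvol k a b"
            using \<rho>_pos by (simp add: field_simps)
          also have "\<dots> \<le> 6 * (2 * M + 3) * (\<Sum>v\<in>B k a b. vol v)"
            unfolding bvol_def vol_def using wc B_V
            by (intro mult_left_mono edge_sum_le_vertex_sum) auto
          finally show ?thesis .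
        qed
        then show "(case ab of (a, b) \<Rightarrow> (\<Sum>e\<in>E. n k a b e * w e) * (2 * bvol k a b / (2 ^ k * \<rho>))) \<le>
            (case ab of (a, b) \<Rightarrow> 6 * (2 * M + 3) * (\<Sum>v\<in>B k a b. vol v))"
          by (simp add: ab)
      qed
      also have "\<dots> = 6 * (2 * M + 3) * (\<Sum>(a, b)\<in>V \<times> V. \<Sum>v\<in>B k a b. vol v)"
        by (simp add: sum_distrib_left case_prod_unfold)
      also have "(\<Sum>(a, b)\<in>V \<times> V. \<Sum>v\<in>B k a b. vol v) =
          (\<Sum>ab\<in>V \<times> V. \<Sum>v\<in>V. if v \<in> B k (fst ab) (snd ab) then vol v else 0)"
        using finite_vertices B_V
        by (auto simp: case_prod_unfold sum.If_cases Int_absorb1 Int_def[symmetric] intro!: sum.cong)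
      also have "\<dots> = (\<Sum>v\<in>V. \<Sum>ab\<in>V \<times> V. if v \<in> B k (fst ab) (snd ab) then vol v else 0)"
        by (rule sum.swap)
      also have "\<dots> = (\<Sum>v\<in>V. vol v * card {ab \<in> V \<times> V. v \<in> B k (fst ab) (snd ab)})"
        using finite_vertices
        by (intro sum.cong refl) (simp add: sum.inter_filter[symmetric] mult.commute)
      also have "\<dots> \<le> (\<Sum>v\<in>V. vol v * (spread cl k v * spread cl (Suc k) v))"
      proof (intro sum_mono mult_left_mono vol_nonneg)
        fix v
        \<comment> \<open>A class whose neighbourhood contains \<open>v\<close> has a member in
          \<open>N k v\<close>, hence also in \<open>N (Suc k) v\<close>. Its two centres are
          therefore seen from \<open>v\<close> at levels \<open>k\<close> and \<open>Suc k\<close>,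
          which leaves at most the product of the two spreads.\<close>
        have "{ab \<in> V \<times> V. v \<in> B k (fst ab) (snd ab)} \<subseteq> cl k ` N k v \<times> cl (Suc k) ` N (Suc k) v"
        proof
          fix ab assume "ab \<in> {ab \<in> V \<times> V. v \<in> B k (fst ab) (snd ab)}"
          then obtain u where u: "v \<in> N k u" "ab = (cl k u, cl (Suc k) u)"
            unfolding B_def U_def by (cases ab) auto
          then have "u \<in> N k v" "u \<in> N (Suc k) v"
            using N_sym N_mono[of k "Suc k" v] by auto
          then show "ab \<in> cl k ` N k v \<times> cl (Suc k) ` N (Suc k) v"
            unfolding u(2) by blast
        qed
        then have "card {ab \<in> V \<times> V. v \<in> B k (fst ab) (snd ab)} \<le>
            card (cl k ` N k v \<times> cl (Suc k) ` N (Suc k) v)"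
          by (intro card_mono) auto
        then show "real (card {ab \<in> V \<times> V. v \<in> B k (fst ab) (snd ab)}) \<le>
            spread cl k v * spread cl (Suc k) v"
          by (simp add: spread_def card_cartesian_product flip: of_nat_mult)
      qed
      finally show "(\<Sum>(a, b)\<in>V \<times> V. (\<Sum>e\<in>E. n k a b e * w e) * (2 * bvol k a b / (2 ^ k * \<rho>))) \<le>
          6 * (2 * M + 3) * (\<Sum>v\<in>V. vol v * spread cl k v * spread cl (Suc k) v)"
        by (simp add: mult.assoc)
    qed
    also have "\<dots> = 6 * (2 * M + 3) * (\<Sum>k<J. \<Sum>v\<in>V. vol v * spread cl k v * spread cl (Suc k) v)"
      by (simp add: sum_distrib_left)
    also have "\<dots> \<le> 6 * (2 * M + 3) * (8 * real J)"
      using spread_sum by (intro mult_left_mono) auto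
    also have "\<dots> = 48 * (2 * M + 3) * J"
      by (simp add: algebra_simps)
    finally show ?thesis .
  qed
  show ?thesis
  proof (rule that[of f x])
    show "load_bound V E c h f x" using load by (simp add: load_bound_def)
    show "path_between V E s t (f s t) \<and> hop (f s t) \<le> 4 * J * (2 * M + 3) * h"
      if "f s t \<noteq> []" for s t using f_path[OF that] by blast
    show "0 \<le> x e" for e
      unfolding x_def using \<rho>_pos bvol_nonneg
      by (intro sum_nonneg) (auto simp: n_def intro!: mult_nonneg_nonneg divide_nonneg_pos)
    show "(\<Sum>e\<in>E. w e * x e) \<le> 48 * (2 * M + 3) * J" by (rule x_sum)
    \<comment> \<open>A path is never the empty list, so among \<open>pairs\<close> the value
      \<open>[]\<close> marks exactly the separated ones.\<close>
    have "{(s, t)\<in>pairs. f s t = []} = {(s, t)\<in>pairs. cl (scale s t) s \<noteq> cl (scale s t) t}"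
      using climb(1) pairs_sub by (fastforce simp: f_def path_between_def)
    then show "(\<Sum>y\<in>{(s, t)\<in>pairs. f s t = []}. q y) \<le> 8 * \<epsilon>"
      using fail by (simp add: case_prod_unfold)
  qed
qed

end

section \<open>From weights to an oblivious routing\<close>

text \<open>This set agrees with \<open>pairs\<close> for each admissible weighting but does not
  depend on the weights, so it can index the minimax argument.\<close>

definition hop_pairs :: "'v set \<Rightarrow> 'v set set \<Rightarrow> nat \<Rightarrow> ('v \<times> 'v) set" where
  "hop_pairs V E h = {(s, t). s \<noteq> t \<and> (\<exists>p. path_between V E s t p \<and> hop p \<le> h)}"

context capacitated_graph begin

lemma hop_pairs_sub: "hop_pairs V E h \<subseteq> V \<times> V"
  by (auto simp: hop_pairs_def dest: path_between_ends)

lemma card_edges_le: "card E \<le> (card V)\<^sup>2"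
proof -
  have "E \<subseteq> (\<lambda>(u, v). {u, v}) ` (V \<times> V)"
  proof
    fix e assume "e \<in> E"
    then obtain u v where "u \<in> V" "v \<in> V" "e = {u, v}" using edge_ends by blast
    then show "e \<in> (\<lambda>(u, v). {u, v}) ` (V \<times> V)" by force
  qed
  then have "card E \<le> card (V \<times> V)"
    using finite_vertices by (meson card_image_le card_mono finite_SigmaI finite_imageI order_trans)
  then show ?thesis by (simp add: card_cartesian_product power2_eq_square)
qed

text \<open>After removal of repeated vertices a walk has at most \<open>card V\<close> edges, each
  of weight at most \<open>L\<close>, and no more hops than before.\<close>

lemma near_top:
  fixes L :: real
  assumes w: "\<And>e. e \<in> E \<Longrightarrow> 0 \<le> w e \<and> w e \<le> L" and L: "0 \<le> L"
    and p: "path_between V E u v p" "hop p \<le> h"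
  shows "near V E w h (card V * L) u v"
proof -
  obtain q where q: "path_between V E u v q" "hop q \<le> hop p" "distinct q"
    using path_between_shortcut[OF p(1)] .
  have "length q \<le> card V"
    using q finite_vertices by (auto simp: path_between_def distinct_card[symmetric] intro: card_mono)
  then have len: "length (path_edges q) \<le> card V" by (simp add: path_edges_def)
  have "path_weight w q \<le> length (path_edges q) * L"
    unfolding path_weight_def
    using sum_list_mono[of "path_edges q" w "\<lambda>_. L"] w path_between_edges[OF q(1)]
    by (auto simp: sum_list_triv)
  also have "\<dots> \<le> card V * L"
    using len L by (intro mult_right_mono) auto
  finally show ?thesis
    unfolding near_def using p q by (meson order_trans)
qed

text \<open>The weights on the edges become \<open>w e = l (Inl e) / c e\<close>, whose volume is at
  most \<open>1\<close>; those on the pairs become \<open>q\<close>. The normalisation makes each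
  part of the payoff at most \<open>1 / 2\<close>: \<open>96\<close> is twice the \<open>48\<close>
  of \<open>routing_of_weights\<close>, and \<open>12 * 8 * \<epsilon>\<close> is
  \<open>1 / 2\<close> for \<open>\<epsilon> = 1 / 192\<close>.\<close>

lemma routing_response:
  fixes l :: "'v set + 'v \<times> 'v \<Rightarrow> real" and h M J :: nat and L :: real
  defines "I \<equiv> Inl ` E \<union> Inr ` hop_pairs V E h"
  assumes L: "1 \<le> L" "\<And>e. e \<in> E \<Longrightarrow> 1 / L \<le> c e \<and> c e \<le> L"
    and M: "real (card V) \<le> (193 / 192) ^ M" and J: "8 * real (card V) ^ 3 * L\<^sup>2 \<le> 2 ^ J" "1 \<le> J"
    and V: "V \<noteq> {}"
    and l: "\<And>i. i \<in> I \<Longrightarrow> 1 / (2 * card I) \<le> l i" "sum l I = 1"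
  obtains f x where "load_bound V E c h f x"
    "\<And>s t. f s t \<noteq> [] \<Longrightarrow> path_between V E s t (f s t) \<and> hop (f s t) \<le> 4 * J * (2 * M + 3) * h"
    "\<And>e. e \<in> E \<Longrightarrow> 0 \<le> x e"
    "(\<Sum>e\<in>E. l (Inl e) * (x e / (c e * (96 * real ((2 * M + 3) * J))))) +
      (\<Sum>(s, t)\<in>hop_pairs V E h. l (Inr (s, t)) * (if f s t = [] then 12 else 0)) \<le> 1"
proof -
  define P where "P = hop_pairs V E h"
  have finP: "finite P" unfolding P_def using hop_pairs_sub finite_vertices finite_subset by blast
  have finI: "finite I" using finP finite_edges by (simp add: I_def P_def)
  have disj: "Inl ` E \<inter> Inr ` P = {}" by auto
  have split: "sum \<phi> I = (\<Sum>e\<in>E. \<phi> (Inl e)) + (\<Sum>y\<in>P. \<phi> (Inr y))"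
    for \<phi> :: "'v set + 'v \<times> 'v \<Rightarrow> real"
    unfolding I_def P_def[symmetric]
    using finP finite_edges disj by (simp add: sum.union_disjoint sum.reindex)
  have l_nonneg: "0 \<le> l i" if "i \<in> I" for i
    using l(1)[OF that] by (rule order_trans[rotated]) simp
  have le1: "l i \<le> 1" if "i \<in> I" for i
    using member_le_sum[OF that, of l] l(2) l_nonneg finI by simp
  define n where "n = real (card V)"
  have n1: "1 \<le> n" using V finite_vertices by (simp add: n_def Suc_le_eq card_gt_0_iff)
  have "card I = card E + card P"
    unfolding I_def P_def[symmetric]
    using finP finite_edges disj by (simp add: card_Un_disjoint card_image)
  moreover have "card P \<le> (card V)\<^sup>2"
    using card_mono[OF _ hop_pairs_sub[of h]] finite_vertices
    by (simp add: P_def card_cartesian_product power2_eq_square)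
  ultimately have "card I \<le> 2 * (card V)\<^sup>2" using card_edges_le by simp
  then have cardI: "real (card I) \<le> 2 * n\<^sup>2"
    unfolding n_def by (metis of_nat_le_iff of_nat_mult of_nat_numeral of_nat_power)
  \<comment> \<open>\<open>card I\<close> is at most \<open>2 * n\<^sup>2\<close> and capacities are
    at most \<open>L\<close>, so every \<open>w e\<close> is at least
    \<open>1 / (4 * n\<^sup>2 * L)\<close>; half of this makes \<open>w_gt\<close> strict. Level
    \<open>J\<close> must reach the weight \<open>n * L\<close> of \<open>near_top\<close>, which is
    the premise on \<open>8 * real (card V) ^ 3 * L\<^sup>2\<close>.\<close>
  define \<rho> where "\<rho> = 1 / (8 * n\<^sup>2 * L)"
  define w where "w e = l (Inl e) / c e" for e
  have inI: "Inl e \<in> I" if "e \<in> E" for e using that by (simp add: I_def)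
  have w_gt: "\<rho> < w e" if "e \<in> E" for e
  proof -
    have cI: "0 < real (card I)" using inI[OF that] finI by (auto simp: card_gt_0_iff)
    have "\<rho> < 1 / (4 * n\<^sup>2) / L"
      using n1 L by (simp add: \<rho>_def field_simps)
    also have "\<dots> \<le> 1 / (2 * card I) / L"
      using cardI cI n1 L by (intro divide_right_mono divide_left_mono) auto
    also have "\<dots> \<le> l (Inl e) / L"
      using l(1)[OF inI[OF that]] L by (intro divide_right_mono) auto
    also have "\<dots> \<le> l (Inl e) / c e"
      using l_nonneg[OF inI[OF that]] L(1) L(2)[OF that] capacity_pos[OF that]
      by (intro divide_left_mono) auto
    finally show ?thesis by (simp add: w_def)
  qed
  have \<rho>: "0 < \<rho>" using n1 L by (simp add: \<rho>_def)
  have w_le: "w e \<le> L" if "e \<in> E" for e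
  proof -
    have "w e \<le> 1 / c e"
      using le1[OF inI[OF that]] capacity_pos[OF that] by (simp add: w_def divide_right_mono)
    also have "\<dots> \<le> L"
      using L(1) L(2)[OF that] capacity_pos[OF that] by (simp add: field_simps)
    finally show ?thesis .
  qed
  interpret W: weighted_levels V E c w h \<rho> "1 / 192" M J
  proof
    fix u v p assume p: "path_between V E u v p" "hop p \<le> h"
    have "n * L \<le> 2 ^ J * \<rho>"
    proof -
      have "n * L * (8 * n\<^sup>2 * L) \<le> 2 ^ J"
        using J(1) by (simp add: n_def power2_eq_square power3_eq_cube mult_ac)
      then show ?thesis using n1 L by (simp add: \<rho>_def pos_le_divide_eq)
    qed
    moreover have "near V E w h (n * L) u v"
      unfolding n_def using near_top[OF _ _ p, of w L] w_gt w_le \<rho> L by fastforce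
    ultimately show "near V E w h (2 ^ J * \<rho>) u v" by (rule near_mono[rotated])
  qed (use \<rho> w_gt M J in auto)
  have pairs: "W.pairs = P"
    unfolding W.pairs_def P_def hop_pairs_def W.N_def
    using W.top path_between_ends by (fastforce simp: near_def)
  have "(\<Sum>e\<in>E. w e * c e) = (\<Sum>e\<in>E. l (Inl e))"
    using less_imp_neq[OF capacity_pos] by (intro sum.cong) (auto simp: w_def)
  moreover have sum1: "(\<Sum>e\<in>E. l (Inl e)) + (\<Sum>y\<in>P. l (Inr y)) = 1"
    using split[of l] l(2) by simp
  moreover have E_nonneg: "0 \<le> (\<Sum>e\<in>E. l (Inl e))" and P_nonneg: "0 \<le> (\<Sum>y\<in>P. l (Inr y))"
    using l_nonneg by (auto intro!: sum_nonneg simp: I_def P_def)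
  ultimately have w1: "(\<Sum>e\<in>E. w e * c e) \<le> 1" and q1: "(\<Sum>y\<in>W.pairs. l (Inr y)) \<le> 1"
    by (simp_all add: pairs)
  have q0: "0 \<le> l (Inr y)" if "y \<in> W.pairs" for y
    using l_nonneg that by (simp add: pairs I_def P_def)
  obtain f x where fx: "load_bound V E c h f x"
    "\<And>s t. f s t \<noteq> [] \<Longrightarrow> path_between V E s t (f s t) \<and> hop (f s t) \<le> 4 * J * (2 * M + 3) * h"
    "\<And>e. e \<in> E \<Longrightarrow> 0 \<le> x e" "(\<Sum>e\<in>E. w e * x e) \<le> 48 * (2 * M + 3) * J"
    "(\<Sum>y\<in>{(s, t)\<in>W.pairs. f s t = []}. l (Inr y)) \<le> 8 * (1 / 192)"
    by (rule W.routing_of_weights[of "\<lambda>y. l (Inr y)", OF w1 q0 q1]) blast+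
  define K where "K = real ((2 * M + 3) * J)"
  have K: "0 < K" using J by (simp add: K_def)
  have "(\<Sum>e\<in>E. l (Inl e) * (x e / (c e * (96 * K)))) = (\<Sum>e\<in>E. w e * x e) / (96 * K)"
    by (simp add: w_def sum_divide_distrib)
  also have "\<dots> \<le> 48 * K / (96 * K)"
    using fx(4) K by (intro divide_right_mono) (auto simp: K_def algebra_simps)
  also have "\<dots> = 1 / 2" using K by simp
  finally have one: "(\<Sum>e\<in>E. l (Inl e) * (x e / (c e * (96 * K)))) \<le> 1 / 2" .
  have "(\<Sum>(s, t)\<in>P. l (Inr (s, t)) * (if f s t = [] then 12 else 0)) =
      (\<Sum>y\<in>P. if f (fst y) (snd y) = [] then 12 * l (Inr y) else 0)"
    by (intro sum.cong) (auto simp: case_prod_unfold)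
  also have "\<dots> = (\<Sum>y | y \<in> P \<and> f (fst y) (snd y) = []. 12 * l (Inr y))"
    by (rule sum.inter_filter[OF finP, symmetric])
  also have "\<dots> = 12 * (\<Sum>y\<in>{(s, t)\<in>W.pairs. f s t = []}. l (Inr y))"
    unfolding sum_distrib_left pairs by (intro sum.cong) auto
  also have "\<dots> \<le> 1 / 2" using fx(5) by simp
  finally have "(\<Sum>e\<in>E. l (Inl e) * (x e / (c e * (96 * real ((2 * M + 3) * J))))) +
      (\<Sum>(s, t)\<in>hop_pairs V E h. l (Inr (s, t)) * (if f s t = [] then 12 else 0)) \<le> 1"
    using one unfolding K_def[symmetric] P_def[symmetric] by linarith
  with fx(1-3) show ?thesis by (rule that)
qed

text \<open>Minimax for payoffs that measure the load of each edge and the failure at each pair. Its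
  constant \<open>6\<close> becomes \<open>6 * 96 = 576\<close> for the loads; against the penalty
  \<open>12\<close> it says that a pair is unserved in at most half of the routings.\<close>

lemma routing_ensemble:
  fixes h M J :: nat and L :: real
  assumes L: "1 \<le> L" "\<And>e. e \<in> E \<Longrightarrow> 1 / L \<le> c e \<and> c e \<le> L"
    and M: "real (card V) \<le> (193 / 192) ^ M" and J: "8 * real (card V) ^ 3 * L\<^sup>2 \<le> 2 ^ J" "1 \<le> J"
    and V: "V \<noteq> {}"
  obtains as :: "(('v \<Rightarrow> 'v \<Rightarrow> 'v list) \<times> ('v set \<Rightarrow> real)) list" where "as \<noteq> []"
    "\<And>f x. (f, x) \<in> set as \<Longrightarrow> load_bound V E c h f x"
    "\<And>f x s t. (f, x) \<in> set as \<Longrightarrow> f s t \<noteq> [] \<Longrightarrow>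
      path_between V E s t (f s t) \<and> hop (f s t) \<le> 4 * J * (2 * M + 3) * h"
    "\<And>e. e \<in> E \<Longrightarrow> (\<Sum>(f, x)\<leftarrow>as. x e) \<le> 576 * (2 * M + 3) * J * length as * c e"
    "\<And>s t. (s, t) \<in> hop_pairs V E h \<Longrightarrow>
      (\<Sum>(f, x)\<leftarrow>as. if f s t = [] then 1 else 0) \<le> real (length as) / 2"
proof -
  define P where "P = hop_pairs V E h"
  have finP: "finite P" unfolding P_def using hop_pairs_sub finite_vertices finite_subset by blast
  define I where "I = Inl ` E \<union> Inr ` P"
  have finI: "finite I" using finP finite_edges by (simp add: I_def)
  define K where "K = real ((2 * M + 3) * J)"
  have K: "0 < K" using J by (simp add: K_def)
  define g :: "('v \<Rightarrow> 'v \<Rightarrow> 'v list) \<times> ('v set \<Rightarrow> real) \<Rightarrow> 'v set + 'v \<times> 'v \<Rightarrow> real"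
    where "g = (\<lambda>(f, x) i. case i of Inl e \<Rightarrow> x e / (c e * (96 * K))
    | Inr (s, t) \<Rightarrow> if f s t = [] then 12 else (0::real))"
  define A where "A = {(f, x). load_bound V E c h f x \<and> (\<forall>s t. f s t \<noteq> [] \<longrightarrow>
      path_between V E s t (f s t) \<and> hop (f s t) \<le> 4 * J * (2 * M + 3) * h) \<and> (\<forall>e\<in>E. 0 \<le> x e)}"
  have "\<exists>as. as \<noteq> [] \<and> set as \<subseteq> A \<and> (\<forall>i\<in>I. (\<Sum>a\<leftarrow>as. g a i) \<le> 6 * length as)"
  proof (cases "I = {}")
    \<comment> \<open>With neither edges nor pairs, the routing that serves nobody satisfies every
      requirement; minimax needs a nonempty index set.\<close>
    case True
    then have "(\<lambda>_ _. [], \<lambda>_. 0) \<in> A"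
      by (auto simp: I_def A_def load_bound_def)
    with True show ?thesis by (intro exI[of _ "[(\<lambda>_ _. [], \<lambda>_. 0)]"]) simp
  next
    case False
    show ?thesis
    proof (rule approximate_minimax[of I A g, OF finI False])
      fix a i assume "a \<in> A" "i \<in> I"
      then show "0 \<le> g a i"
        using K capacity_pos
        by (auto simp: g_def A_def I_def less_imp_le intro!: divide_nonneg_nonneg split: sum.split)
    next
      fix l assume l: "\<And>i. i \<in> I \<Longrightarrow> 1 / (2 * card I) \<le> l i" "sum l I = (1::real)"
      obtain f x where fx: "load_bound V E c h f x"
        "\<And>s t. f s t \<noteq> [] \<Longrightarrow> path_between V E s t (f s t) \<and> hop (f s t) \<le> 4 * J * (2 * M + 3) * h"
        "\<And>e. e \<in> E \<Longrightarrow> 0 \<le> x e"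
        "(\<Sum>e\<in>E. l (Inl e) * (x e / (c e * (96 * real ((2 * M + 3) * J))))) +
        (\<Sum>(s, t)\<in>hop_pairs V E h. l (Inr (s, t)) * (if f s t = [] then 12 else 0)) \<le> 1"
        by (rule routing_response[of L M J h l, OF L M J V l[unfolded I_def P_def]])
          (assumption | (rule that; (assumption | blast)))+
      have "(\<Sum>i\<in>I. l i * g (f, x) i) =
          (\<Sum>e\<in>E. l (Inl e) * g (f, x) (Inl e)) + (\<Sum>y\<in>P. l (Inr y) * g (f, x) (Inr y))"
        unfolding I_def using finP finite_edges
        by (subst sum.union_disjoint) (auto simp: sum.reindex)
      also have "\<dots> \<le> 1"
        using fx(4) unfolding K_def[symmetric] P_def[symmetric]
          by (simp add: g_def case_prod_unfold)
      finally show "\<exists>a\<in>A. (\<Sum>i\<in>I. l i * g a i) \<le> 1"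
        using fx(1-3) by (intro bexI[of _ "(f, x)"]) (auto simp: A_def)
    qed blast
  qed
  then obtain as where as: "as \<noteq> []" "set as \<subseteq> A"
    "\<And>i. i \<in> I \<Longrightarrow> (\<Sum>a\<leftarrow>as. g a i) \<le> 6 * length as"
    by blast
  show ?thesis
  proof (rule that[of as])
    show "as \<noteq> []" by fact
    show "load_bound V E c h f x" if "(f, x) \<in> set as" for f x
      using as(2) that by (auto simp: A_def)
    show "path_between V E s t (f s t) \<and> hop (f s t) \<le> 4 * J * (2 * M + 3) * h"
      if "(f, x) \<in> set as" "f s t \<noteq> []" for f x s t
      using as(2) that unfolding A_def by blast
    show "(\<Sum>(f, x)\<leftarrow>as. x e) \<le> 576 * (2 * M + 3) * J * length as * c e" if e: "e \<in> E" for e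
    proof -
      have "(\<Sum>(f, x)\<leftarrow>as. x e) / (c e * (96 * K)) = (\<Sum>a\<leftarrow>as. g a (Inl e))"
        by (induction as) (auto simp: g_def add_divide_distrib)
      also have "\<dots> \<le> 6 * length as" using as(3) e by (simp add: I_def)
      finally have "(\<Sum>(f, x)\<leftarrow>as. x e) \<le> 6 * length as * (c e * (96 * K))"
        using K capacity_pos[OF e] by (simp add: pos_divide_le_eq)
      also have "\<dots> = 576 * (2 * M + 3) * J * length as * c e"
        by (simp add: K_def algebra_simps)
      finally show ?thesis .
    qed
    show "(\<Sum>(f, x)\<leftarrow>as. if f s t = [] then 1 else 0) \<le> real (length as) / 2"
      if st: "(s, t) \<in> hop_pairs V E h" for s t
    proof -
      have "12 * (\<Sum>(f, x)\<leftarrow>as. if f s t = [] then 1 else 0) = (\<Sum>a\<leftarrow>as. g a (Inr (s, t)))"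
        by (induction as) (auto simp: g_def)
      also have "\<dots> \<le> 6 * length as" using as(3) st by (simp add: I_def P_def)
      finally show ?thesis by simp
    qed
  qed
qed

text \<open>Each pair within \<open>h\<close> hops draws uniformly from the routings of the ensemble
  that serve it. These are at least half of them, so conditioning on being served at most doubles
  the average load, and \<open>576\<close> turns into \<open>1152\<close>.\<close>

lemma oblivious_routing_exists:
  fixes h M J :: nat and L :: real
  assumes L: "1 \<le> L" "\<And>e. e \<in> E \<Longrightarrow> 1 / L \<le> c e \<and> c e \<le> L"
    and M: "real (card V) \<le> (193 / 192) ^ M" and J: "8 * real (card V) ^ 3 * L\<^sup>2 \<le> 2 ^ J" "1 \<le> J"
    and V: "V \<noteq> {}" and \<beta>: "real (4 * J * (2 * M + 3) * h) \<le> \<beta>"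
  obtains R where "routing_scheme V E (pairs_within V E \<beta>) R" "hop_bounded (pairs_within V E \<beta>) \<beta> R"
    "\<And>D \<kappa> e. hop_routable V E c h D \<kappa> \<Longrightarrow> e \<in> E \<Longrightarrow>
      demand_flow V D R e \<le> ennreal (1152 * real ((2 * M + 3) * J) * \<kappa> * c e)"
proof -
  obtain as :: "(('v \<Rightarrow> 'v \<Rightarrow> 'v list) \<times> ('v set \<Rightarrow> real)) list" where as: "as \<noteq> []"
    "\<And>f x. (f, x) \<in> set as \<Longrightarrow> load_bound V E c h f x"
    "\<And>f x s t. (f, x) \<in> set as \<Longrightarrow> f s t \<noteq> [] \<Longrightarrow>
      path_between V E s t (f s t) \<and> hop (f s t) \<le> 4 * J * (2 * M + 3) * h"
    "\<And>e. e \<in> E \<Longrightarrow> (\<Sum>(f, x)\<leftarrow>as. x e) \<le> 576 * (2 * M + 3) * J * length as * c e"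
    "\<And>s t. (s, t) \<in> hop_pairs V E h \<Longrightarrow>
      (\<Sum>(f, x)\<leftarrow>as. if f s t = [] then 1 else 0) \<le> real (length as) / 2"
    by (rule routing_ensemble[where h = h, OF L M J V]) (assumption | (rule that; blast))+
  define T where "T = length as"
  have T: "0 < T" using as(1) by (simp add: T_def)
  define f where "f i = fst (as ! i)" for i
  define x where "x i = snd (as ! i)" for i
  have nth: "(f i, x i) \<in> set as" if "i < T" for i
    using that by (simp add: f_def x_def T_def)
  have list_sum: "(\<Sum>(f, x)\<leftarrow>as. \<phi> f x) = (\<Sum>i<T. \<phi> (f i) (x i))"
    for \<phi> :: "_ \<Rightarrow> _ \<Rightarrow> real"
    by (simp add: sum_list_sum_nth T_def f_def x_def case_prod_unfold atLeast0LessThan)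
  define G where "G s t = {i. i < T \<and> f i s t \<noteq> []}" for s t
  have finG: "finite (G s t)" for s t by (simp add: G_def)
  have cardG: "real T / 2 \<le> card (G s t)" if "(s, t) \<in> hop_pairs V E h" for s t
  proof -
    have "(\<Sum>i<T. if f i s t = [] then 1 else 0) \<le> real T / 2"
      using as(5)[OF that] list_sum[of "\<lambda>f x. if f s t = [] then 1 else 0"] by (simp add: T_def)
    moreover have "(\<Sum>i<T. if f i s t = [] then 1 else (0::real)) + card (G s t) = T"
    proof -
      have "real (card (G s t)) = (\<Sum>i<T. if f i s t \<noteq> [] then 1 else 0)"
        unfolding G_def by (simp add: sum.If_cases) (auto intro!: arg_cong[of _ _ card])
      then have "(\<Sum>i<T. if f i s t = [] then 1 else (0::real)) + card (G s t) =
          (\<Sum>i<T. (if f i s t = [] then 1 else 0) + (if f i s t \<noteq> [] then 1 else 0))"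
        by (simp add: sum.distrib)
      also have "\<dots> = (\<Sum>i<T. 1)" by (intro sum.cong) auto
      finally show ?thesis by simp
    qed
    ultimately show ?thesis by linarith
  qed
  \<comment> \<open>The pairs outside \<open>hop_pairs\<close> add no flow for a routable demand:
    equal ends get the path without hops, and distinct ends carry no demand. They still need a legal
    path whenever \<open>\<beta>\<close> hops can join them.\<close>
  define R where "R s t = (if (s, t) \<in> hop_pairs V E h
    then map_pmf (\<lambda>i. f i s t) (pmf_of_set (G s t))
    else return_pmf (if s = t then [s]
      else SOME p. path_between V E s t p \<and> real (hop p) \<le> \<beta>))" for s t
  have \<beta>0: "0 \<le> \<beta>" using \<beta> by (rule order_trans[rotated]) simp
  have R_path: "path_between V E s t p \<and> real (hop p) \<le> \<beta>"
    if st: "(s, t) \<in> pairs_within V E \<beta>" and p: "p \<in> set_pmf (R s t)" for s t p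
  proof (cases "(s, t) \<in> hop_pairs V E h")
    case True
    have "G s t \<noteq> {}" using cardG[OF True] T by auto
    then obtain i where i: "i < T" "f i s t \<noteq> []" "p = f i s t"
      using p True finG by (auto simp: R_def G_def)
    then have "path_between V E s t p \<and> hop p \<le> 4 * J * (2 * M + 3) * h"
      using as(3)[OF nth] by blast
    then show ?thesis using \<beta> by (metis of_nat_le_iff order_trans)
  next
    case False
    show ?thesis
    proof (cases "s = t")
      case True
      then show ?thesis using False p st \<beta>0 by (simp add: R_def hop_def pairs_within_def)
    next
      case ne: False
      have "\<exists>p. path_between V E s t p \<and> real (hop p) \<le> \<beta>"
        using st by (simp add: pairs_within_def)
      from someI_ex[OF this] show ?thesis using False ne p by (simp add: R_def)
    qed
  qed
  show ?thesis
  proof (rule that[of R])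
    show "routing_scheme V E (pairs_within V E \<beta>) R" "hop_bounded (pairs_within V E \<beta>) \<beta> R"
      using R_path by (auto simp: routing_scheme_def hop_bounded_def)
  next
    fix D \<kappa> e assume D: "hop_routable V E c h D \<kappa>" and e: "e \<in> E"
    define m where "m i s t = real (count_list (path_edges (f i s t)) e)" for i s t
    have \<kappa>: "0 \<le> \<kappa>" and D_nonneg: "\<And>s t. s \<in> V \<Longrightarrow> t \<in> V \<Longrightarrow> 0 \<le> D s t"
      using D by (auto simp: hop_routable_def is_demand_def)
    have one: "ennreal (D s t) * (\<integral>\<^sup>+p. path_flow p e \<partial>measure_pmf (R s t)) \<le>
        ennreal (D s t * (2 / T * (\<Sum>i<T. m i s t)))" if st: "s \<in> V" "t \<in> V" for s t
    proof (cases "(s, t) \<in> hop_pairs V E h")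
      case True
      have c: "real T / 2 \<le> card (G s t)" by (rule cardG[OF True])
      then have c0: "0 < real (card (G s t))" using T by linarith
      then have ne: "G s t \<noteq> {}" by auto
      have "(\<integral>\<^sup>+p. path_flow p e \<partial>measure_pmf (R s t)) =
          (\<Sum>i\<in>G s t. ennreal (m i s t)) / card (G s t)"
        using True by (simp add: R_def nn_integral_pmf_of_set[OF ne finG] path_flow_def m_def
            ennreal_of_nat_eq_real_of_nat del: sum_ennreal)
      also have "\<dots> = ennreal ((\<Sum>i\<in>G s t. m i s t) / card (G s t))"
        using c0 by (simp add: m_def divide_ennreal sum_nonneg ennreal_of_nat_eq_real_of_nat)
      also have "\<dots> \<le> ennreal (2 / T * (\<Sum>i<T. m i s t))"
      proof (rule ennreal_leI)
        have "(\<Sum>i\<in>G s t. m i s t) / card (G s t) \<le> (\<Sum>i<T. m i s t) / (T / 2)"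
          using c c0 T by (intro frac_le sum_mono2 sum_nonneg) (auto simp: m_def G_def)
        then show "(\<Sum>i\<in>G s t. m i s t) / card (G s t) \<le> 2 / T * (\<Sum>i<T. m i s t)"
          by (simp add: field_simps)
      qed
      finally have "ennreal (D s t) * (\<integral>\<^sup>+p. path_flow p e \<partial>measure_pmf (R s t)) \<le>
          ennreal (D s t) * ennreal (2 / T * (\<Sum>i<T. m i s t))"
        by (rule mult_left_mono) simp
      moreover have "0 \<le> 2 / T * (\<Sum>i<T. m i s t)"
        by (intro mult_nonneg_nonneg sum_nonneg) (auto simp: m_def)
      ultimately show ?thesis
        by (simp only: ennreal_mult[OF D_nonneg[OF st]])
    next
      case False
      show ?thesis
      proof (cases "s = t")
        case True
        then show ?thesis using False by (simp add: R_def path_flow_def)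
      next
        case ne: False
        have "\<not> D s t > 0"
        proof
          assume "D s t > 0"
          then have supp: "(s, t) \<in> demand_support V D"
            using st by (simp add: demand_support_def)
          obtain R' where R': "routing_scheme V E (demand_support V D) R'"
            "hop_bounded (demand_support V D) (real h) R'"
            using D by (auto simp: hop_routable_def)
          obtain p where "p \<in> set_pmf (R' s t)" using set_pmf_not_empty[of "R' s t"] by blast
          then have "path_between V E s t p \<and> hop p \<le> h"
            using R' supp by (auto simp: routing_scheme_def hop_bounded_def)
          then show False using False ne by (auto simp: hop_pairs_def)
        qed
        then show ?thesis by (simp add: ennreal_neg)
      qed
    qed
    have "demand_flow V D R e \<le> (\<Sum>s\<in>V. \<Sum>t\<in>V. ennreal (D s t * (2 / T * (\<Sum>i<T. m i s t))))"
      unfolding demand_flow_def by (intro sum_mono one)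
    also have "\<dots> = ennreal (\<Sum>s\<in>V. \<Sum>t\<in>V. D s t * (2 / T * (\<Sum>i<T. m i s t)))"
    proof -
      have nn: "0 \<le> D s t * (2 / T * (\<Sum>i<T. m i s t))" if "s \<in> V" "t \<in> V" for s t
        by (intro mult_nonneg_nonneg sum_nonneg D_nonneg[OF that]) (auto simp: m_def)
      have "(\<Sum>s\<in>V. \<Sum>t\<in>V. ennreal (D s t * (2 / T * (\<Sum>i<T. m i s t)))) =
          (\<Sum>s\<in>V. ennreal (\<Sum>t\<in>V. D s t * (2 / T * (\<Sum>i<T. m i s t))))"
        using nn by (intro sum.cong sum_ennreal) auto
      also have "\<dots> = ennreal (\<Sum>s\<in>V. \<Sum>t\<in>V. D s t * (2 / T * (\<Sum>i<T. m i s t)))"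
        using nn by (intro sum_ennreal sum_nonneg) auto
      finally show ?thesis .
    qed
    also have "(\<Sum>s\<in>V. \<Sum>t\<in>V. D s t * (2 / T * (\<Sum>i<T. m i s t))) =
        2 / T * (\<Sum>i<T. \<Sum>s\<in>V. \<Sum>t\<in>V. D s t * m i s t)"
    proof -
      have "(\<Sum>s\<in>V. \<Sum>t\<in>V. D s t * (2 / T * (\<Sum>i<T. m i s t))) =
          2 / T * (\<Sum>s\<in>V. \<Sum>t\<in>V. \<Sum>i<T. D s t * m i s t)"
        by (simp add: sum_distrib_left mult_ac)
      also have "(\<Sum>s\<in>V. \<Sum>t\<in>V. \<Sum>i<T. D s t * m i s t) = (\<Sum>s\<in>V. \<Sum>i<T. \<Sum>t\<in>V. D s t * m i s t)"
        by (intro sum.cong refl) (rule sum.swap)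
      also have "\<dots> = (\<Sum>i<T. \<Sum>s\<in>V. \<Sum>t\<in>V. D s t * m i s t)"
        by (rule sum.swap)
      finally show ?thesis .
    qed
    also have "ennreal (2 / T * (\<Sum>i<T. \<Sum>s\<in>V. \<Sum>t\<in>V. D s t * m i s t)) \<le>
        ennreal (1152 * real ((2 * M + 3) * J) * \<kappa> * c e)"
    proof (rule ennreal_leI)
      have "(\<Sum>i<T. \<Sum>s\<in>V. \<Sum>t\<in>V. D s t * m i s t) \<le> (\<Sum>i<T. \<kappa> * x i e)"
        using as(2)[OF nth] D e unfolding load_bound_def m_def by (intro sum_mono) auto
      also have "\<dots> = \<kappa> * (\<Sum>i<T. x i e)" by (simp add: sum_distrib_left)
      also have "\<dots> \<le> \<kappa> * (576 * (2 * M + 3) * J * T * c e)"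
        using as(4)[OF e] list_sum[of "\<lambda>_ x. x e"] \<kappa> by (intro mult_left_mono) (auto simp: T_def)
      finally have "2 / T * (\<Sum>i<T. \<Sum>s\<in>V. \<Sum>t\<in>V. D s t * m i s t) \<le>
          2 / T * (\<kappa> * (576 * (2 * M + 3) * J * T * c e))"
        by (rule mult_left_mono) simp
      also have "\<dots> = 1152 * real ((2 * M + 3) * J) * \<kappa> * c e"
        using T by (simp add: field_simps)
      finally show "2 / T * (\<Sum>i<T. \<Sum>s\<in>V. \<Sum>t\<in>V. D s t * m i s t) \<le>
          1152 * real ((2 * M + 3) * J) * \<kappa> * c e" .
    qed
    finally show "demand_flow V D R e \<le> ennreal (1152 * real ((2 * M + 3) * J) * \<kappa> * c e)" .
  qed
qed

end

section \<open>Comparison with the optimum\<close>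

lemma hop_oblivious_congestion:
  assumes D: "is_demand V D" and \<alpha>: "0 < \<alpha>"
    and c: "\<And>e. e \<in> E \<Longrightarrow> 0 < c e"
    and R: "\<And>\<kappa> e. hop_routable V E c h D \<kappa> \<Longrightarrow> e \<in> E \<Longrightarrow> demand_flow V D R e \<le> ennreal (\<alpha> * \<kappa> * c e)"
  shows "demand_congestion V E c D R \<le> ennreal \<alpha> * hop_opt V E c h D"
proof -
  \<comment> \<open>Each competing scheme \<open>R'\<close> is treated separately, with its own
    finite congestion as \<open>\<kappa>\<close>; then \<open>R'\<close> itself witnesses
    \<open>hop_routable\<close>.\<close>
  have le: "demand_congestion V E c D R \<le> ennreal \<alpha> * demand_congestion V E c D R'"
    if R': "routing_scheme V E (demand_support V D) R'" "hop_bounded (demand_support V D) (real h) R'"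
    for R'
  proof (cases "demand_congestion V E c D R' = \<top>")
    case True
    then show ?thesis using \<alpha> by (simp add: ennreal_mult_top)
  next
    case False
    define \<kappa> where "\<kappa> = enn2real (demand_congestion V E c D R')"
    have \<kappa>: "ennreal \<kappa> = demand_congestion V E c D R'" "0 \<le> \<kappa>"
      using False by (simp_all add: \<kappa>_def less_top)
    have "demand_flow V D R' e \<le> ennreal (\<kappa> * c e)" if e: "e \<in> E" for e
    proof -
      have "demand_flow V D R' e / ennreal (c e) \<le> ennreal \<kappa>"
        unfolding \<kappa>(1) demand_congestion_def flow_congestion_def by (rule SUP_upper[OF e])
      then have "demand_flow V D R' e / ennreal (c e) * ennreal (c e) \<le> ennreal \<kappa> * ennreal (c e)"
        by (rule mult_right_mono) simp
      then show ?thesis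
        using c[OF e] \<kappa>(2) by (simp add: ennreal_divide_times mult_divide_eq_ennreal ennreal_mult)
    qed
    then have "hop_routable V E c h D \<kappa>"
      using D R' \<kappa>(2) by (auto simp: hop_routable_def)
    then have flow: "demand_flow V D R e \<le> ennreal (\<alpha> * \<kappa> * c e)" if "e \<in> E" for e
      using R that by blast
    show ?thesis
      unfolding \<kappa>(1)[symmetric]
      unfolding demand_congestion_def[of V E c D R] flow_congestion_def
    proof (rule SUP_least)
      fix e assume e: "e \<in> E"
      have "demand_flow V D R e / ennreal (c e) \<le> ennreal (\<alpha> * \<kappa> * c e) / ennreal (c e)"
        by (rule divide_right_mono_ennreal[OF flow[OF e]])
      also have "\<dots> = ennreal (\<alpha> * \<kappa> * c e / c e)"
        using c[OF e] \<alpha> \<kappa>(2) by (intro divide_ennreal) auto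
      also have "\<dots> = ennreal \<alpha> * ennreal \<kappa>"
        using c[OF e] \<alpha> \<kappa>(2) by (simp add: ennreal_mult)
      finally show "demand_flow V D R e / ennreal (c e) \<le> ennreal \<alpha> * ennreal \<kappa>" .
    qed
  qed
  \<comment> \<open>Division by \<open>\<alpha>\<close> turns the claim into a lower bound for an
    infimum, so no product has to be taken through it.\<close>
  have "demand_congestion V E c D R / ennreal \<alpha> \<le> hop_opt V E c h D"
    unfolding hop_opt_def
    using le \<alpha> by (intro INF_greatest divide_le_posI_ennreal) auto
  then have "demand_congestion V E c D R / ennreal \<alpha> * ennreal \<alpha> \<le> hop_opt V E c h D * ennreal \<alpha>"
    by (rule mult_right_mono) simp
  then have "demand_congestion V E c D R \<le> hop_opt V E c h D * ennreal \<alpha>"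
    using \<alpha> by (simp add: ennreal_divide_times mult_divide_eq_ennreal)
  then show ?thesis
    by (simp only: mult.commute)
qed

section \<open>Polynomial bounds and logarithms\<close>

lemma polynomially_bounded_explicit:
  assumes "polynomially_bounded L"
  obtains A :: real and k where "1 \<le> A" "\<And>n. 1 \<le> n \<Longrightarrow> \<bar>L n\<bar> \<le> A * real n ^ k"
proof -
  obtain k where "L \<in> O(\<lambda>n. real n ^ k)"
    using assms by (auto simp: polynomially_bounded_def)
  then obtain C where C: "C > 0" "eventually (\<lambda>n. norm (L n) \<le> C * norm (real n ^ k)) sequentially"
    by (elim landau_o.bigE)
  then obtain n0 where n0: "\<And>n. n0 \<le> n \<Longrightarrow> \<bar>L n\<bar> \<le> C * real n ^ k"
    by (auto simp: eventually_sequentially)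
  \<comment> \<open>The asymptotic bound says nothing below \<open>n0\<close>; the finitely many
    values there are added to the constant.\<close>
  define A where "A = 1 + C + (\<Sum>i<n0. \<bar>L i\<bar>)"
  have S: "0 \<le> (\<Sum>i<n0. \<bar>L i\<bar>)" by (simp add: sum_nonneg)
  have "\<bar>L n\<bar> \<le> A * real n ^ k" if n: "1 \<le> n" for n
  proof (cases "n0 \<le> n")
    case True
    have "\<bar>L n\<bar> \<le> C * real n ^ k" by (rule n0[OF True])
    also have "\<dots> \<le> A * real n ^ k" using S by (intro mult_right_mono) (auto simp: A_def)
    finally show ?thesis .
  next
    case False
    have "\<bar>L n\<bar> \<le> (\<Sum>i<n0. \<bar>L i\<bar>)" using False by (intro member_le_sum) auto
    also have "\<dots> \<le> A" using C by (simp add: A_def)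
    also have "A = A * 1" by simp
    also have "\<dots> \<le> A * real n ^ k"
      using n S C by (intro mult_left_mono) (auto simp: A_def one_le_power)
    finally show ?thesis .
  qed
  then show ?thesis using S C that[of A k] by (simp add: A_def)
qed

lemma ln_gt_one:
  assumes "3 \<le> (x :: real)"
  shows "1 < ln x"
proof -
  have "exp 1 < x" using e_less_272 assms by linarith
  then have "ln (exp 1) < ln x" using assms by (subst ln_less_cancel_iff) auto
  then show ?thesis by simp
qed

text \<open>As \<open>h * ln n\<close> is never \<open>1\<close>, the outer logarithm does not vanish; it is negative only at
  \<open>n = 2\<close>, \<open>h = 1\<close>.\<close>

lemma ln_scaled_ln_lower_bound:
  obtains \<delta> :: real where "0 < \<delta>"
    "\<And>n h :: nat. 2 \<le> n \<Longrightarrow> 1 \<le> h \<Longrightarrow> \<delta> \<le> (ln (real h * ln (real n)))\<^sup>2"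
proof -
  define \<delta> where "\<delta> = min ((ln (ln 3))\<^sup>2) ((ln (ln 2))\<^sup>2 :: real)"
  have ln2: "0 < ln (2::real)" "ln (2::real) < 1" using ln_2_less_1 by auto
  have ln3: "1 < ln (3::real)" by (rule ln_gt_one) simp
  have big: "(ln (ln 3))\<^sup>2 \<le> (ln y)\<^sup>2" if "ln 3 \<le> y" for y :: real
    using that ln3 by (intro power_mono) auto
  show ?thesis
  proof (rule that[of \<delta>])
    have "ln (ln 2) < (0::real)" using ln2 by simp
    then show "0 < \<delta>" using ln3 by (simp add: \<delta>_def)
    fix n h :: nat assume n: "2 \<le> n" and h: "1 \<le> h"
    consider "n = 2" "h = 1" | "n = 2" "2 \<le> h" | "3 \<le> n" using n h by linarith
    then show "\<delta> \<le> (ln (real h * ln (real n)))\<^sup>2"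
    proof cases
      case 1
      then show ?thesis by (simp add: \<delta>_def)
    next
      case 2
      have "ln (3::real) \<le> ln (2 ^ 2)" by simp
      also have "\<dots> = 2 * ln 2" by (simp only: ln_realpow of_nat_numeral)
      also have "\<dots> \<le> real h * ln 2" using 2 ln2 by (intro mult_right_mono) auto
      finally show ?thesis using big 2 by (simp add: \<delta>_def min_le_iff_disj)
    next
      case 3
      have "1 * ln (3::real) \<le> real h * ln (real n)" using 3 h by (intro mult_mono) auto
      then show ?thesis using big by (simp add: \<delta>_def min_le_iff_disj)
    qed
  qed
qed

text \<open>Rounding and the constant \<open>A\<close> cost only a constant factor because
  \<open>ln n\<close> is at least \<open>ln 2\<close>. The lemma supplies the number
  \<open>M\<close> of growing rounds and the number \<open>J\<close> of levels.\<close>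

lemma logarithmic_exponent:
  assumes b: "1 < (b :: real)" and A: "1 \<le> A"
  obtains B where "0 < B"
    "\<And>n::nat. 2 \<le> n \<Longrightarrow> \<exists>M::nat. 1 \<le> M \<and> A * real n ^ k \<le> b ^ M \<and> real M \<le> B * ln (real n)"
proof -
  define a where "a = (ln A / ln 2 + k) / ln b"
  have ln2: "0 < ln (2::real)" by simp
  have lnb: "0 < ln b" using b by simp
  have a: "0 \<le> a" using lnb A by (simp add: a_def)
  show ?thesis
  proof (rule that[of "a + 1 / ln 2"])
    show "0 < a + 1 / ln 2" using a by (simp add: add_nonneg_pos)
    fix n :: nat assume n: "2 \<le> n"
    have lnn: "ln 2 \<le> ln (real n)" using n by simp
    define M where "M = nat \<lfloor>a * ln n\<rfloor> + 1"
    have al: "0 \<le> a * ln n" using a lnn ln2 by (intro mult_nonneg_nonneg) linarith+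
    have M: "a * ln n \<le> M" "M \<le> a * ln n + 1" using al unfolding M_def by linarith+
    have "ln A \<le> ln A / ln 2 * ln n"
      using A lnn ln2 mult_left_mono[OF lnn, of "ln A / ln 2"] by simp
    then have "ln A + k * ln n \<le> (ln A / ln 2 + k) * ln n"
      by (simp add: distrib_right)
    also have "\<dots> = a * ln n * ln b" using lnb by (simp add: a_def)
    also have "\<dots> \<le> M * ln b" using M lnb by (intro mult_right_mono) auto
    finally have "ln (A * real n ^ k) \<le> ln (b ^ M)"
      using A n b by (simp add: ln_mult ln_realpow)
    then have "A * real n ^ k \<le> b ^ M"
      using A n b by (subst (asm) ln_le_cancel_iff) auto
    moreover have "real M \<le> (a + 1 / ln 2) * ln n"
    proof -
      have "1 \<le> ln n / ln 2" using lnn ln2 by (simp only: le_divide_eq_1_pos)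
      moreover have "(a + 1 / ln 2) * ln n = a * ln n + ln n / ln 2"
        by (simp add: distrib_right)
      ultimately show ?thesis using M(2) by linarith
    qed
    ultimately show "\<exists>M::nat. 1 \<le> M \<and> A * real n ^ k \<le> b ^ M \<and> real M \<le> (a + 1 / ln 2) * ln (real n)"
      by (intro exI[of _ M]) (simp add: M_def)
  qed
qed

theorem theorem3p1:
  fixes L :: "nat \<Rightarrow> real"
  assumes "polynomially_bounded L"
  shows "\<exists>C\<^sub>1>0. \<exists>C\<^sub>2>0. \<forall>(V :: 'v set) (E :: 'v set set) (c :: 'v set \<Rightarrow> real) (n :: nat) (h :: nat).
           capacitated_graph V E c \<longrightarrow> card V = n \<longrightarrow> n \<ge> 2 \<longrightarrow>
           (\<forall>e\<in>E. c e \<in> {1 / L n .. L n}) \<longrightarrow> h \<ge> 1 \<longrightarrow>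
           (\<exists>R \<beta> \<alpha>.
              hop_oblivious_routing V E h \<beta> R \<and>
              \<beta> \<le> C\<^sub>1 * ln (real n) ^ 7 \<and>
              congestion_approximation V E c h \<alpha> R \<and>
              \<alpha> \<le> C\<^sub>2 * ln (real n) ^ 2 * ln (real h * ln (real n)) ^ 2)"
proof -
  obtain A k where A: "1 \<le> A" "\<And>n. 1 \<le> n \<Longrightarrow> \<bar>L n\<bar> \<le> A * real n ^ k"
    using polynomially_bounded_explicit[OF assms] by blast
  obtain B1 where B1: "0 < B1"
    "\<And>n::nat. 2 \<le> n \<Longrightarrow> \<exists>M::nat. 1 \<le> M \<and> 1 * real n ^ 1 \<le> (193 / 192) ^ M \<and> real M \<le> B1 * ln (real n)"
    by (rule logarithmic_exponent[of "193 / 192" 1 1]) auto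
  have "1 * 1 \<le> 8 * A\<^sup>2" using A(1) by (intro mult_mono) (auto simp: one_le_power)
  \<comment> \<open>This is \<open>8 * n ^ 3 * L\<^sup>2\<close> from
    \<open>oblivious_routing_exists\<close> with \<open>A * n ^ k\<close> as the bound on the
    capacities.\<close>
  then obtain B2 where B2: "0 < B2"
    "\<And>n::nat. 2 \<le> n \<Longrightarrow> \<exists>J::nat. 1 \<le> J \<and> 8 * A\<^sup>2 * real n ^ (3 + 2 * k) \<le> 2 ^ J \<and> real J \<le> B2 * ln (real n)"
    using logarithmic_exponent[of 2 "8 * A\<^sup>2" "3 + 2 * k"] by (metis mult_1 one_less_numeral_iff semiring_norm(76))
  obtain \<delta> :: real where \<delta>: "0 < \<delta>"
    "\<And>n h :: nat. 2 \<le> n \<Longrightarrow> 1 \<le> h \<Longrightarrow> \<delta> \<le> (ln (real h * ln (real n)))\<^sup>2"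
    by (rule ln_scaled_ln_lower_bound) blast
  have ln2: "0 < ln (2::real)" by simp
  define B where "B = B2 * (2 * B1 + 3 / ln 2)"
  have B: "0 < B" using B1(1) B2(1) ln2 by (simp add: B_def add_pos_pos)
  \<comment> \<open>Stretch and approximation are both multiples of \<open>(2 * M + 3) * J\<close>,
    which is at most \<open>B * ln n ^ 2\<close>. The surplus factors in the claim are at least
    \<open>ln 2 ^ 5\<close> and \<open>\<delta>\<close>, and the two constants are divided by
    these.\<close>
  define C1 where "C1 = 4 * B / ln 2 ^ 5"
  define C2 where "C2 = 1152 * B / \<delta>"
  have pos: "0 < C1" "0 < C2" using B \<delta>(1) by (simp_all add: C1_def C2_def)
  show ?thesis
  proof (rule exI[of _ C1], rule conjI, rule pos(1), rule exI[of _ C2], rule conjI, rule pos(2),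
      intro allI impI)
    fix V :: "'v set" and E c and n h :: nat
    assume "capacitated_graph V E c" and card: "card V = n" and n: "2 \<le> n"
      and cap: "\<forall>e\<in>E. c e \<in> {1 / L n .. L n}" and h: "1 \<le> h"
    then interpret capacitated_graph V E c by simp
    define l where "l = ln (real n)"
    have l: "ln 2 \<le> l" using n by (simp add: l_def)
    then have l0: "0 < l" using ln2 by linarith
    obtain M where M: "1 \<le> M" "real n \<le> (193 / 192) ^ M" "real M \<le> B1 * l"
      using B1(2)[OF n] by (auto simp: l_def)
    obtain J where J: "1 \<le> J" "8 * A\<^sup>2 * real n ^ (3 + 2 * k) \<le> 2 ^ J" "real J \<le> B2 * l"
      using B2(2)[OF n] by (auto simp: l_def)
    define K where "K = (2 * M + 3) * J"
    have K: "real K \<le> B * l\<^sup>2"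
    proof -
      have "3 \<le> 3 / ln 2 * l"
        using mult_left_mono[OF l, of "3 / ln 2"] ln2 by simp
      moreover have "(2 * B1 + 3 / ln 2) * l = 2 * (B1 * l) + 3 / ln 2 * l"
        by (simp add: distrib_right)
      ultimately have "real (2 * M + 3) \<le> (2 * B1 + 3 / ln 2) * l"
        using M(3) by simp
      then have "real (2 * M + 3) * real J \<le> (2 * B1 + 3 / ln 2) * l * (B2 * l)"
        using J(3) B1(1) ln2 l0 by (intro mult_mono) (auto simp: add_pos_pos less_imp_le)
      then show ?thesis by (simp add: K_def B_def power2_eq_square mult_ac)
    qed
    have "0 < K" using J(1) by (simp add: K_def)
    then have K1: "1 \<le> real K" by linarith
    define \<beta> where "\<beta> = C1 * l ^ 7"
    define \<alpha> where "\<alpha> = C2 * l ^ 2 * ln (real h * l) ^ 2"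
    have \<beta>: "4 * real K \<le> \<beta>"
    proof -
      have "4 * real K \<le> 4 * B * l\<^sup>2" using K by simp
      also have "\<dots> = 4 * B / ln 2 ^ 5 * (ln 2 ^ 5 * l\<^sup>2)" by simp
      also have "\<dots> \<le> 4 * B / ln 2 ^ 5 * (l ^ 5 * l\<^sup>2)"
        using l ln2 B by (intro mult_left_mono mult_right_mono power_mono) auto
      also have "\<dots> = \<beta>" by (simp add: \<beta>_def C1_def power_add[symmetric])
      finally show ?thesis .
    qed
    have \<alpha>: "1152 * real K \<le> \<alpha>"
    proof -
      have "1152 * real K \<le> 1152 * B * l\<^sup>2" using K by simp
      also have "\<dots> = C2 * l\<^sup>2 * \<delta>" using \<delta>(1) by (simp add: C2_def)
      also have "\<dots> \<le> \<alpha>"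
        unfolding \<alpha>_def l_def using \<delta>(2)[OF n h] B \<delta>(1)
        by (intro mult_left_mono) (auto simp: C2_def)
      finally show ?thesis .
    qed
    \<comment> \<open>An edge forces \<open>L n\<close> to be at least \<open>1\<close>, since a
      positive capacity lies between \<open>1 / L n\<close> and \<open>L n\<close>. Without edges
      \<open>L n\<close> may be any real, and the maximum restores the lower bound.\<close>
    define L' where "L' = max 1 (L n)"
    have L': "1 \<le> L'" by (simp add: L'_def)
    have capL: "1 / L' \<le> c e \<and> c e \<le> L'" if e: "e \<in> E" for e
    proof -
      have c: "1 / L n \<le> c e" "c e \<le> L n" using cap e by auto
      have pos: "0 < L n" using capacity_pos[OF e] c(2) by linarith
      have "1 \<le> L n"
      proof (rule ccontr)
        assume "\<not> 1 \<le> L n"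
        then have "1 < 1 / L n" using pos by simp
        then show False using c \<open>\<not> 1 \<le> L n\<close> by linarith
      qed
      then show ?thesis using c by (simp add: L'_def)
    qed
    have "L' \<le> A * real n ^ k"
    proof -
      have "1 * 1 \<le> A * real n ^ k" using A(1) n by (intro mult_mono) (auto simp: one_le_power)
      then show ?thesis using A(2)[of n] n by (auto simp: L'_def)
    qed
    then have "8 * real n ^ 3 * L'\<^sup>2 \<le> 8 * real n ^ 3 * (A * real n ^ k)\<^sup>2"
      using L' by (intro mult_left_mono power_mono) auto
    also have "\<dots> = 8 * A\<^sup>2 * real n ^ (3 + 2 * k)"
      by (simp add: power_add power_mult_distrib power_mult[symmetric] mult.commute)
    also have "\<dots> \<le> 2 ^ J" by (rule J(2))
    finally have J': "8 * real (card V) ^ 3 * L'\<^sup>2 \<le> 2 ^ J" by (simp add: card)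
    have M': "real (card V) \<le> (193 / 192) ^ M" using M(2) by (simp add: card)
    have V: "V \<noteq> {}" using card n by auto
    have hops: "real (4 * J * (2 * M + 3) * h) \<le> \<beta> * real h"
      using mult_right_mono[OF \<beta>, of "real h"] by (simp add: K_def mult_ac)
    obtain R where R: "routing_scheme V E (pairs_within V E (\<beta> * real h)) R"
      "hop_bounded (pairs_within V E (\<beta> * real h)) (\<beta> * real h) R"
      "\<And>D \<kappa> e. hop_routable V E c h D \<kappa> \<Longrightarrow> e \<in> E \<Longrightarrow>
        demand_flow V D R e \<le> ennreal (1152 * real ((2 * M + 3) * J) * \<kappa> * c e)"
      by (rule oblivious_routing_exists[where h = h, OF L' capL M' J' J(1) V hops])
        (assumption | (rule that; (assumption | blast)))+
    have "demand_congestion V E c D R \<le> ennreal \<alpha> * hop_opt V E c h D" if D: "is_demand V D" for D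
    proof (rule hop_oblivious_congestion[OF D])
      show "0 < \<alpha>" using \<alpha> K1 by linarith
      show "0 < c e" if "e \<in> E" for e using capacity_pos[OF that] .
      fix \<kappa> e assume \<kappa>: "hop_routable V E c h D \<kappa>" and e: "e \<in> E"
      have "demand_flow V D R e \<le> ennreal (1152 * real K * \<kappa> * c e)"
        using R(3)[OF \<kappa> e] by (simp add: K_def)
      also have "\<dots> \<le> ennreal (\<alpha> * \<kappa> * c e)"
        using \<alpha> \<kappa> capacity_pos[OF e]
        by (intro ennreal_leI mult_right_mono) (auto simp: hop_routable_def)
      finally show "demand_flow V D R e \<le> ennreal (\<alpha> * \<kappa> * c e)" .
    qed
    moreover have "1 \<le> \<alpha>" "1 \<le> \<beta>" using \<alpha> \<beta> K1 by linarith+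
    ultimately show "\<exists>R \<beta> \<alpha>. hop_oblivious_routing V E h \<beta> R \<and> \<beta> \<le> C1 * ln (real n) ^ 7 \<and>
        congestion_approximation V E c h \<alpha> R \<and>
        \<alpha> \<le> C2 * ln (real n) ^ 2 * ln (real h * ln (real n)) ^ 2"
      using R(1,2) unfolding hop_oblivious_routing_def congestion_approximation_def
      by (intro exI[of _ R] exI[of _ \<beta>] exI[of _ \<alpha>]) (auto simp: \<alpha>_def \<beta>_def l_def)
  qed
qed

end
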